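(* Let $C\subseteq\mathbb R^d$ be a $p$-convex set ($p\in\mathbb N$) with $|C|=1$, let $\mathbf c_n=(c_{n,1},\dots,c_{n,d})$ be vectors with $0<c_{n,\ell}\to\infty$ for each $\ell$, and let $D_n=(\mathbf c_nC)\cap\mathbb Z^d$. Let $(\xi_v)_{v\in\mathbb Z^d}$ be a stationary real-valued random field satisfying condition $\mathcal D(x_n;K_n)$ for some real sequence $(x_n)_{n\in\mathbb N}$, with associated vectors $\boldsymbol\gamma_n$ and constants $\alpha_n$. Let $(k_n)$ be a sequence of integers satisfying $k_n\to\infty$, $k_n\alpha_n\to0$ and $k_n^{1/d}\boldsymbol\gamma_n=o(\mathbf c_n)$ as $n\to\infty$, such that condition $\mathcal D^\ell(x_n;k_n;1)$ is satisfied. Let $(B_n^1)_{n\in\mathbb N},\dots,(B_n^G)_{n\in\mathbb N}$ be sequences of sets in $\mathbb Z^d$, each satisfying the geometric assumption, such that $B_n^g\subseteq D_n$ for all $n$ and $g$, and $B_n^1,\dots,B_n^G$ are pairwise disjoint. Assume furthermore that $\lim_{n\to\infty}|B_n^g|/|D_n|=b_g$ for each $g=1,\dots,G$, where $0\le b_g<\infty$. If for some $0<\tau<\infty$, $|D_n|\,\mathbb P(\xi_0>x_n)\to\tau$, then $$(\overline L_n(B_n^1),\dots,\overline L_n(B_n^G))\stackrel{\mathcal D}{\to}(\overline L^1,\dots,\overline L^G)$$ in distribution as $n\to\infty$, where $\overline L^1,\dots,\overline L^G$ are independent random variables with each $\overline L^g$ being Poisson distributed with parameter $b_g\tau$. (Here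 $b_g=0$ means that $\mathbb P(\overline L^g=0)=1$.)
   Context: Notation: $d\in\mathbb N$; $|\cdot|$ denotes the Euclidean norm of a point, Lebesgue measure of a full-dimensional subset of $\mathbb R^d$, and cardinality of a subset of $\mathbb Z^d$. For vectors $\mathbf r=(r_1,\dots,r_d)$ and $A\subseteq\mathbb R^d$, $\mathbf rA=\{(r_1a_1,\dots,r_da_d):a\in A\}$. $A\oplus B$ is the Minkowski sum, $B(1)$ the closed Euclidean unit ball. $\mathbf r_n=o(\mathbf c_n)$ means $r_{n,\ell}/c_{n,\ell}\to0$ for each $\ell$. $M_\xi(A)=\max_{v\in A}\xi_v$, with $M_\xi(\emptyset)=-\infty$. A convex body is a compact convex subset of $\mathbb R^d$ with non-empty interior; a set is $p$-convex if it is a union of $p$ convex bodies. Write $C_n=\mathbf c_nC$. Geometric assumption on a sequence $(B_n)$ of subsets of $\mathbb Z^d$: there are $q\in\mathbb N$ and $q$-convex sets $\overline B_n=\bigcup_{i=1}^q\overline B_{n,i}$ with $B_n=\overline B_n\cap\mathbb Z^d$ and $|\overline B_n|\to\infty$, and vectors $\mathbf b_n=(b_{n,1},\dots,b_{n,d})$ with $0<b_{n,\ell}<\infty$ such that (i) $b_{n,\ell}\to\infty$ for all $\ell$; (ii) $b_{n,1}\cdots b_{n,d}\sim|\overline B_n|$; (iii) for some $0<c<\infty$, $\overline B_n\subseteq\mathbf b_n[-c,c]^d$ for all $n$. (The number $q$ and vectors $\mathbf b_n$ may differ for different sequences.) Boxes: every sequence $(k_n)$ considered consists of positive integers with $k_n\to\infty$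 and $k_n^{1/d}=o(c_{n,\ell})$ for all $\ell$. Put $t_{n,k_n}^\ell=\lfloor c_{n,\ell}/k_n^{1/d}\rfloor$, $\mathbf t_{n,k_n}=(t_{n,k_n}^1,\dots,t_{n,k_n}^d)$, and for $z\in\mathbb Z^d$, $I_z^{n,k_n}=\mathbf t_{n,k_n}(z+[0,1)^d)$, $J_z^{n,k_n}=I_z^{n,k_n}\cap\mathbb Z^d$, and $D_{n,k_n}^+=\bigcup\{J_z^{n,k_n}: I_z^{n,k_n}\cap C_n\ne\emptyset\}$. $K_n=\mathbb Z^d\cap\mathbf c_n[-c,c]^d$, where $0<c<\infty$ is a fixed constant (which can be chosen independently of $(k_n)$) such that $D_{n,k_n}^+\subseteq K_n$ for all $n$. Condition $\mathcal D(x_n;K_n)$: sets $A,B\subseteq\mathbb Z^d$ are $\boldsymbol\gamma$-separated if $B\subseteq(A\oplus\boldsymbol\gamma B(1))^c$. The condition holds for $(\xi_v)$ if there is an increasing sequence of $d$-dimensional vectors $\boldsymbol\gamma_n$ with $\boldsymbol\gamma_n=o(\mathbf c_n)$ and constants $\alpha_n\to0$ such that for all $n$ and all $\boldsymbol\gamma_n$-separated $A,B\subseteq K_n$, at least one of which is a box, $|\mathbb P(M_\xi(A\cup B)\le x_n)-\mathbb P(M_\xi(A)\le x_n)\mathbb P(M_\xi(B)\le x_n)|\le\alpha_n$. Order: $\preceq$ is an arbitrary fixed translation invariant total order on $\mathbb Z^d$, and $A_v^{n,k_n}=\{z\in(v+\mathbf t_{n,k_n}[-1,1]^d)\cap\mathbb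 Z^d: v\prec z\}$. Condition $\mathcal D^\ell(x_n;k_n;1)$: $\mathbb P(M_\xi(A_0^{n,k_n})\le x_n\mid\xi_0>x_n)\to1$ as $n\to\infty$. Exceedance process on $\mathbb Z^d$: $\overline L_n(A)=\sum_{z\in\mathbb Z^d}\mathbf 1_{A\cap D_n}(z)\mathbf 1_{\{\xi_z>x_n\}}$ for $A\subseteq\mathbb Z^d$. *)

theory Defs
  imports "HOL-Probability.Probability" "HOL-Library.Landau_Symbols"
begin

text \<open>
  The lattice is the type \<open>int ^ 'd\<close>, with \<open>d = CARD('d)\<close>; \<open>rvec\<close> embeds it in \<open>real ^ 'd\<close>.
  Multiplication and the order \<open>\<le>\<close> on vectors are componentwise.
\<close>

definition rvec :: "int ^ 'd \<Rightarrow> real ^ 'd" where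
  "rvec z = (\<chi> l. real_of_int (z $ l))"

definition lattice_pts :: "(real ^ 'd) set \<Rightarrow> (int ^ 'd) set" where
  "lattice_pts A = {z. rvec z \<in> A}"

definition scale_set :: "real ^ 'd \<Rightarrow> (real ^ 'd) set \<Rightarrow> (real ^ 'd) set" where
  "scale_set r A = (\<lambda>a. r * a) ` A"

definition vec_smallo :: "(nat \<Rightarrow> real ^ 'd) \<Rightarrow> (nat \<Rightarrow> real ^ 'd) \<Rightarrow> bool" where
  "vec_smallo r c \<longleftrightarrow> (\<forall>l. (\<lambda>n. r n $ l / c n $ l) \<longlonglongrightarrow> 0)"

definition convex_body :: "(real ^ 'd) set \<Rightarrow> bool" where
  "convex_body A \<longleftrightarrow> compact A \<and> convex A \<and> interior A \<noteq> {}"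

definition p_convex :: "nat \<Rightarrow> (real ^ 'd) set \<Rightarrow> bool" where
  "p_convex p A \<longleftrightarrow> (\<exists>K. (\<forall>i<p. convex_body (K i)) \<and> A = (\<Union>i<p. K i))"

definition geometric_assumption :: "(nat \<Rightarrow> (int ^ 'd) set) \<Rightarrow> bool" where
  "geometric_assumption B \<longleftrightarrow>
    (\<exists>(q::nat) (Bbar :: nat \<Rightarrow> (real ^ 'd) set) (b :: nat \<Rightarrow> real ^ 'd).
       1 \<le> q \<and>
       (\<forall>n. p_convex q (Bbar n)) \<and>
       (\<forall>n. B n = lattice_pts (Bbar n)) \<and>
       filterlim (\<lambda>n. measure lebesgue (Bbar n)) at_top sequentially \<and>
       (\<forall>n l. 0 < b n $ l) \<and>
       (\<forall>l. filterlim (\<lambda>n. b n $ l) at_top sequentially) \<and>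
       (\<lambda>n. \<Prod>l\<in>UNIV. b n $ l) \<sim>[sequentially] (\<lambda>n. measure lebesgue (Bbar n)) \<and>
       (\<exists>c::real. 0 < c \<and>
          (\<forall>n. Bbar n \<subseteq> scale_set (b n) (cbox (vec (- c)) (vec c)))))"

definition box_len :: "real ^ 'd \<Rightarrow> nat \<Rightarrow> int ^ 'd" where
  "box_len c k = (\<chi> l. \<lfloor>c $ l / root CARD('d) (real k)\<rfloor>)"

definition I_box :: "real ^ 'd \<Rightarrow> nat \<Rightarrow> int ^ 'd \<Rightarrow> (real ^ 'd) set" where
  "I_box c k z =
     scale_set (rvec (box_len c k)) ((\<lambda>y. rvec z + y) ` {y. \<forall>l. 0 \<le> y $ l \<and> y $ l < 1})"

definition J_box :: "real ^ 'd \<Rightarrow> nat \<Rightarrow> int ^ 'd \<Rightarrow> (int ^ 'd) set" where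
  "J_box c k z = lattice_pts (I_box c k z)"

definition D_plus :: "(real ^ 'd) set \<Rightarrow> real ^ 'd \<Rightarrow> nat \<Rightarrow> (int ^ 'd) set" where
  "D_plus C c k = (\<Union>z\<in>{z. I_box c k z \<inter> scale_set c C \<noteq> {}}. J_box c k z)"

definition K_set :: "real \<Rightarrow> real ^ 'd \<Rightarrow> (int ^ 'd) set" where
  "K_set \<kappa> c = lattice_pts (scale_set c (cbox (vec (- \<kappa>)) (vec \<kappa>)))"

definition stationary_field :: "'a measure \<Rightarrow> (int ^ 'd \<Rightarrow> 'a \<Rightarrow> real) \<Rightarrow> bool" where
  "stationary_field M \<xi> \<longleftrightarrow>
     (\<forall>w. distr M (Pi\<^sub>M UNIV (\<lambda>_. borel)) (\<lambda>\<omega> v. \<xi> (v + w) \<omega>)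
        = distr M (Pi\<^sub>M UNIV (\<lambda>_. borel)) (\<lambda>\<omega> v. \<xi> v \<omega>))"

text \<open>
  In the extended reals the supremum over a finite nonempty set is the maximum,
  and over the empty set it is \<open>-\<infinity>\<close>.
\<close>

definition max_field :: "(int ^ 'd \<Rightarrow> 'a \<Rightarrow> real) \<Rightarrow> (int ^ 'd) set \<Rightarrow> 'a \<Rightarrow> ereal" where
  "max_field \<xi> A \<omega> = (SUP v\<in>A. ereal (\<xi> v \<omega>))"

text \<open>In the next definition, \<open>+\<close> on sets is the Minkowski sum.\<close>

definition separated :: "real ^ 'd \<Rightarrow> (int ^ 'd) set \<Rightarrow> (int ^ 'd) set \<Rightarrow> bool" where
  "separated \<gamma> A B \<longleftrightarrow> rvec ` B \<subseteq> - (rvec ` A + scale_set \<gamma> (cball 0 1))"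

text \<open>Since \<open>\<le>\<close> is componentwise, \<open>{a..b}\<close> is a product of integer intervals.\<close>

definition lattice_box :: "(int ^ 'd) set \<Rightarrow> bool" where
  "lattice_box A \<longleftrightarrow> (\<exists>a b. A = {a..b})"

definition cond_D ::
  "'a measure \<Rightarrow> (int ^ 'd \<Rightarrow> 'a \<Rightarrow> real) \<Rightarrow> (nat \<Rightarrow> real ^ 'd) \<Rightarrow> (nat \<Rightarrow> real)
     \<Rightarrow> (nat \<Rightarrow> (int ^ 'd) set) \<Rightarrow> (nat \<Rightarrow> real ^ 'd) \<Rightarrow> (nat \<Rightarrow> real) \<Rightarrow> bool" where
  "cond_D M \<xi> c x K \<gamma> \<alpha> \<longleftrightarrow>
     mono \<gamma> \<and> vec_smallo \<gamma> c \<and> \<alpha> \<longlonglongrightarrow> 0 \<and>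
     (\<forall>n A B. A \<subseteq> K n \<longrightarrow> B \<subseteq> K n \<longrightarrow> separated (\<gamma> n) A B \<longrightarrow> lattice_box A \<or> lattice_box B \<longrightarrow>
        \<bar>\<P>(\<omega> in M. max_field \<xi> (A \<union> B) \<omega> \<le> ereal (x n))
          - \<P>(\<omega> in M. max_field \<xi> A \<omega> \<le> ereal (x n))
            * \<P>(\<omega> in M. max_field \<xi> B \<omega> \<le> ereal (x n))\<bar> \<le> \<alpha> n)"

text \<open>Orders are sets of pairs: \<open>(u, v) \<in> R\<close> means that \<open>u\<close> precedes or equals \<open>v\<close>.\<close>

definition translation_invariant_order :: "((int ^ 'd) \<times> (int ^ 'd)) set \<Rightarrow> bool" where
  "translation_invariant_order R \<longleftrightarrow>
     linear_order R \<and> (\<forall>u v w. (u, v) \<in> R \<longrightarrow> (u + w, v + w) \<in> R)"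

definition A_set ::
  "((int ^ 'd) \<times> (int ^ 'd)) set \<Rightarrow> real ^ 'd \<Rightarrow> nat \<Rightarrow> int ^ 'd \<Rightarrow> (int ^ 'd) set" where
  "A_set R c k v =
     {z \<in> lattice_pts ((\<lambda>y. rvec v + y) ` scale_set (rvec (box_len c k)) (cbox (vec (- 1)) (vec 1))).
        (v, z) \<in> R \<and> v \<noteq> z}"

definition cond_Dl ::
  "'a measure \<Rightarrow> (int ^ 'd \<Rightarrow> 'a \<Rightarrow> real) \<Rightarrow> ((int ^ 'd) \<times> (int ^ 'd)) set
     \<Rightarrow> (nat \<Rightarrow> real ^ 'd) \<Rightarrow> (nat \<Rightarrow> real) \<Rightarrow> (nat \<Rightarrow> nat) \<Rightarrow> bool" where
  "cond_Dl M \<xi> R c x k \<longleftrightarrow>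
     (\<lambda>n. \<P>(\<omega> in M. max_field \<xi> (A_set R (c n) (k n) 0) \<omega> \<le> ereal (x n) \<bar> x n < \<xi> 0 \<omega>))
       \<longlonglongrightarrow> 1"

definition exceedances ::
  "(int ^ 'd \<Rightarrow> 'a \<Rightarrow> real) \<Rightarrow> (int ^ 'd) set \<Rightarrow> real \<Rightarrow> (int ^ 'd) set \<Rightarrow> 'a \<Rightarrow> real" where
  "exceedances \<xi> D x A \<omega> =
     (\<Sum>\<^sub>\<infinity>z\<in>UNIV. indicat_real (A \<inter> D) z * indicat_real {x<..} (\<xi> z \<omega>))"

text \<open>The library constant \<open>poisson_pmf\<close> is specified only for positive rates.\<close>

definition poisson_law :: "real \<Rightarrow> nat pmf" where
  "poisson_law r = (if r = 0 then return_pmf 0 else poisson_pmf r)"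

text \<open>
  The library's \<open>weak_conv_m\<close> covers only measures on the real line, so weak convergence
  is defined here through bounded continuous test functions.
\<close>

definition weakly_converges :: "(nat \<Rightarrow> 'b::topological_space measure) \<Rightarrow> 'b measure \<Rightarrow> bool" where
  "weakly_converges \<mu> \<nu> \<longleftrightarrow>
     (\<forall>f :: 'b \<Rightarrow> real. continuous_on UNIV f \<longrightarrow> bounded (range f) \<longrightarrow>
        (\<lambda>n. \<integral>y. f y \<partial>\<mu> n) \<longlonglongrightarrow> (\<integral>y. f y \<partial>\<nu>))"

definition converges_in_distribution ::
  "'a measure \<Rightarrow> (nat \<Rightarrow> 'a \<Rightarrow> 'b::topological_space) \<Rightarrow> 'c measure \<Rightarrow> ('c \<Rightarrow> 'b) \<Rightarrow> bool" where
  "converges_in_distribution M X N Y \<longleftrightarrow>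
     weakly_converges (\<lambda>n. distr M borel (X n)) (distr N borel Y)"

end

theory Submission
  imports Defs
begin

text \<open>
  Cover the lattice by about \<open>k n\<close> blocks of side lengths \<open>t n\<close> and keep, for each \<open>g\<close>, the blocks
  contained in \<open>B g n\<close>, shrunk so that distinct blocks are separated by more than \<open>\<gamma> n\<close>. A separating
  hyperplane argument shows that only \<open>O(k^((d-1)/d))\<close> blocks meet the boundary of a convex set, so
  the kept blocks carry almost all points of \<open>B g n\<close>. By the local condition the number of kept blocks
  with an exceedance has asymptotically the same mean as the number of exceedances, and since it is
  never larger, the two are close in mean. The joint Laplace transform of the block counts is a mixture
  of probabilities that there is no exceedance in a union of blocks. Such a probability factorises up to
  \<open>O(k n * \<alpha> n)\<close>, hence the Laplace transforms at integer points converge to those of independent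
  Poisson variables, which suffices for weak convergence.
\<close>

section \<open>Lattice blocks and convex sets\<close>

text \<open>The sets \<open>B g n\<close> may change shape with \<open>n\<close>, so the count of
  boundary blocks has to be uniform over convex sets. The hyperplane argument yields such a bound
  with constants depending only on the dimension. Each boundary block holds at most the k-th part of
  the product of the \<open>c n $ l\<close> lattice points, so together these blocks carry a
  fraction of order k^(-1/d) of \<open>D n\<close>.

  The mixing condition asks one of the two sets to be a box. Blocks are therefore split off one at a
  time, each at cost \<alpha> n, and with O(k n) blocks the total vanishes. The condition speaks
  only of the absence of exceedances; Laplace transforms come within reach because an exponential of
  a 0-1 variable is affine in that variable, so that the product over blocks expands into void
  probabilities.

  The probability that a block has an exceedance is pinned from above by the union bound and from
  below by a disjoint decomposition, each term of which is controlled by the local condition. Block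
  counts are measured against |D n| rather than |B g n|, which lets \<open>b g = 0\<close> be
  treated together with the other cases.\<close>

lemma finite_card_lattice_interval:
  fixes a b :: "int ^ 'd"
  shows finite_lattice_interval: "finite {a..b}"
    and card_lattice_interval: "card {a..b} = (\<Prod>l\<in>UNIV. nat (b $ l - a $ l + 1))"
proof -
  have bij: "bij_betw vec_nth {a..b} (Pi\<^sub>E UNIV (\<lambda>l. {a $ l..b $ l}))"
    by (rule bij_betwI[where g = vec_lambda]) (auto simp: less_eq_vec_def PiE_iff Pi_iff)
  have "finite (Pi\<^sub>E UNIV (\<lambda>l. {a $ l..b $ l}))" by (intro finite_PiE) auto
  with bij show "finite {a..b}" using bij_betw_finite by blast
  from bij have "card {a..b} = card (Pi\<^sub>E UNIV (\<lambda>l. {a $ l..b $ l}))"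
    by (rule bij_betw_same_card)
  then show "card {a..b} = (\<Prod>l\<in>UNIV. nat (b $ l - a $ l + 1))" by (simp add: card_PiE)
qed

text \<open>\<open>t\<close> is the spacing of the base points and \<open>s\<close> the side
  lengths. For positive \<open>t\<close> the sets \<open>block t t z\<close> tile the lattice, and
  \<open>block t s z\<close> with \<open>s \<le> t\<close> is a tile cut back on its upper faces; a
  nonpositive side makes it empty.\<close>

definition block :: "int ^ 'd \<Rightarrow> int ^ 'd \<Rightarrow> int ^ 'd \<Rightarrow> (int ^ 'd) set" where
  "block t s z = {t * z..t * z + s - 1}"

lemma block_iff: "v \<in> block t s z \<longleftrightarrow> (\<forall>l. t $ l * z $ l \<le> v $ l \<and> v $ l < t $ l * z $ l + s $ l)"
  by (auto simp: block_def less_eq_vec_def)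

lemma finite_block: "finite (block t s z)"
  by (simp add: block_def finite_lattice_interval)

lemma card_block: "card (block t s z) = (\<Prod>l\<in>UNIV. nat (s $ l))"
  by (simp add: block_def card_lattice_interval)

lemma lattice_box_block: "lattice_box (block t s z)"
  by (auto simp: block_def lattice_box_def)

lemma lattice_box_empty: "lattice_box {}"
proof -
  have "{1..0 :: int ^ 'd} = {}" by (simp add: less_eq_vec_def)
  then show ?thesis unfolding lattice_box_def by metis
qed

lemma block_mono:
  assumes "\<And>l. s $ l \<le> s' $ l"
  shows "block t s z \<subseteq> block t s' z"
proof
  fix v assume v: "v \<in> block t s z"
  have "v $ l < t $ l * z $ l + s' $ l" for l
    using v assms[of l] by (force simp: block_iff dest: spec[of _ l])
  with v show "v \<in> block t s' z" by (simp add: block_iff)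
qed

lemma block_translate: "block t s z = (\<lambda>v. v + t * z) ` block t s 0"
proof -
  have "v \<in> (\<lambda>v. v + t * z) ` block t s 0" if "v \<in> block t s z" for v
    by (rule image_eqI[where x = "v - t * z"]) (use that in \<open>auto simp: block_iff algebra_simps\<close>)
  then show ?thesis by (auto simp: block_iff algebra_simps)
qed

lemma block_div:
  assumes "\<And>l. 0 < t $ l"
  shows "v \<in> block t t (\<chi> l. v $ l div t $ l)"
proof -
  have "v $ l < t $ l * (v $ l div t $ l) + t $ l" for l
    using mult_div_mod_eq[of "t $ l" "v $ l"] pos_mod_bound[OF assms, of "v $ l" l] by linarith
  moreover have "t $ l * (v $ l div t $ l) \<le> v $ l" for l
    using mult_div_mod_eq[of "t $ l" "v $ l"] pos_mod_sign[OF assms, of "v $ l" l] by linarith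
  ultimately show ?thesis by (simp add: block_iff)
qed

text \<open>In a coordinate where the indices differ the base points are at least
  \<open>t $ l\<close> apart, while a block reaches at most \<open>s $ l - 1\<close> beyond its
  base. The strict inequality is what \<open>far\<close> requires when \<gamma> equals the removed
  margin.\<close>

lemma block_gap:
  assumes t: "\<And>l. 0 < t $ l" and s: "\<And>l. s $ l \<le> t $ l" and "z \<noteq> z'"
    and v: "v \<in> block t s z" and w: "w \<in> block t s z'"
  shows "\<exists>l. t $ l - s $ l < \<bar>v $ l - w $ l\<bar>"
proof -
  from \<open>z \<noteq> z'\<close> obtain l where "z $ l \<noteq> z' $ l" by (metis vec_eq_iff)
  then consider "z $ l + 1 \<le> z' $ l" | "z' $ l + 1 \<le> z $ l" by linarith
  then have "t $ l - s $ l < \<bar>v $ l - w $ l\<bar>"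
  proof cases
    case 1
    then have "t $ l * (z $ l + 1) \<le> t $ l * z' $ l" using t[of l] by (intro mult_left_mono) auto
    then have "t $ l * z $ l + t $ l \<le> t $ l * z' $ l" by (simp add: algebra_simps)
    moreover have "v $ l < t $ l * z $ l + s $ l" "t $ l * z' $ l \<le> w $ l"
      using v w by (auto simp: block_iff)
    ultimately show ?thesis by linarith
  next
    case 2
    then have "t $ l * (z' $ l + 1) \<le> t $ l * z $ l" using t[of l] by (intro mult_left_mono) auto
    then have "t $ l * z' $ l + t $ l \<le> t $ l * z $ l" by (simp add: algebra_simps)
    moreover have "w $ l < t $ l * z' $ l + s $ l" "t $ l * z $ l \<le> v $ l"
      using v w by (auto simp: block_iff)
    ultimately show ?thesis by linarith
  qed
  then show ?thesis ..
qed

lemma block_disjoint: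
  assumes "\<And>l. 0 < t $ l" "\<And>l. s $ l \<le> t $ l" "z \<noteq> z'"
  shows "block t s z \<inter> block t s z' = {}"
  using block_gap[OF assms] assms(2) by (fastforce simp: not_less[symmetric])

text \<open>Points of \<open>B\<close> stay outside boxes with half sides
  \<open>\<bar>\<gamma> $ l\<bar>\<close>, which contain the ellipsoids occurring in
  \<open>separated\<close>. Being a condition on pairs of points, it passes to unions of
  blocks.\<close>

definition far :: "real ^ 'd \<Rightarrow> (int ^ 'd) set \<Rightarrow> (int ^ 'd) set \<Rightarrow> bool" where
  "far \<gamma> A B \<longleftrightarrow> (\<forall>v\<in>A. \<forall>w\<in>B. \<exists>l. \<bar>\<gamma> $ l\<bar> < real_of_int \<bar>v $ l - w $ l\<bar>)"

lemma far_imp_separated: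
  assumes "far \<gamma> A B"
  shows "separated \<gamma> A B"
proof -
  have False if vw: "v \<in> A" "w \<in> B" and y: "y \<in> cball 0 1" "rvec w = rvec v + \<gamma> * y" for v w y
  proof -
    obtain l where l: "\<bar>\<gamma> $ l\<bar> < real_of_int \<bar>v $ l - w $ l\<bar>" using assms vw unfolding far_def by blast
    have "\<bar>y $ l\<bar> \<le> 1" using component_le_norm_cart[of y l] y(1) by simp
    then have "\<bar>\<gamma> $ l * y $ l\<bar> \<le> \<bar>\<gamma> $ l\<bar>" by (simp add: abs_mult mult_left_le)
    moreover have "real_of_int (w $ l) = real_of_int (v $ l) + \<gamma> $ l * y $ l"
      using arg_cong[OF y(2), of "\<lambda>u. u $ l"] by (simp add: rvec_def)
    ultimately show False using l by simp
  qed
  then show ?thesis unfolding separated_def scale_set_def set_plus_def by auto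
qed

section \<open>Boundary blocks of a convex set\<close>

text \<open>Let \<open>u\<close> be the normal of a hyperplane separating \<open>Q\<close> from
  \<open>y\<close>, and \<open>e\<close> its sign vector. A block displaced from \<open>z\<close>
  along \<open>e\<close> lies beyond \<open>y\<close> in every coordinate, so each summand of
  \<open>u \<bullet> (rvec w - rvec y)\<close> is at least \<open>\<bar>u $ l\<bar>\<close>; since
  \<open>u\<close> is nonzero, \<open>rvec w\<close> lies strictly beyond the hyperplane.\<close>

lemma separating_sign_direction:
  fixes Q :: "(real ^ 'd) set"
  assumes "convex Q" and t: "\<And>l. 0 < t $ l" and y: "y \<in> block t t z" "rvec y \<notin> Q"
  obtains e :: "int ^ 'd" where "\<And>l. e $ l \<in> {-1, 1}"
    "\<And>j w. 2 \<le> j \<Longrightarrow> w \<in> block t t (\<chi> l. z $ l + j * e $ l) \<Longrightarrow> rvec w \<notin> Q"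
proof (cases "Q = {}")
  case True
  show ?thesis by (rule that[of 1]) (auto simp: True)
next
  case False
  then obtain u r where u: "u \<noteq> 0" "\<forall>q\<in>Q. u \<bullet> q \<le> r" "r \<le> u \<bullet> rvec y"
    using separating_hyperplane_sets[of Q "{rvec y}"] assms by auto
  \<comment> \<open>Zero components of \<open>u\<close> contribute nothing to the inner product;
    giving them the sign 1 makes \<open>e\<close> nonzero in every coordinate, so one fixed
    coordinate can parametrise each line in direction \<open>e\<close>.\<close>
  define e :: "int ^ 'd" where "e = (\<chi> l. if u $ l \<ge> 0 then 1 else -1)"
  show ?thesis
  proof (rule that[of e])
    show "e $ l \<in> {-1, 1}" for l by (simp add: e_def)
    fix j w assume j: "(2::int) \<le> j" and w: "w \<in> block t t (\<chi> l. z $ l + j * e $ l)"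
    have comp: "\<bar>u $ l\<bar> \<le> u $ l * (rvec w $ l - rvec y $ l)" for l
    proof -
      have yl: "t $ l * z $ l \<le> y $ l" "y $ l < t $ l * z $ l + t $ l" using y by (auto simp: block_iff)
      have wl: "t $ l * (z $ l + j * e $ l) \<le> w $ l" "w $ l < t $ l * (z $ l + j * e $ l) + t $ l"
        using w by (auto simp: block_iff)
      have tj: "2 * t $ l \<le> j * t $ l" using j t[of l] by simp
      show ?thesis
      proof (cases "u $ l \<ge> 0")
        case True
        have "t $ l * (z $ l + j * e $ l) = t $ l * z $ l + j * t $ l"
          using True by (simp add: e_def algebra_simps)
        with yl wl tj have "1 \<le> w $ l - y $ l" by linarith
        then have "1 \<le> rvec w $ l - rvec y $ l" by (simp add: rvec_def flip: of_int_diff)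
        from mult_left_mono[OF this, of "u $ l"] True show ?thesis by simp
      next
        case False
        have "t $ l * (z $ l + j * e $ l) = t $ l * z $ l - j * t $ l"
          using False by (simp add: e_def algebra_simps)
        with yl wl tj have "1 \<le> y $ l - w $ l" by linarith
        then have "1 \<le> rvec y $ l - rvec w $ l" by (simp add: rvec_def flip: of_int_diff)
        from mult_left_mono[OF this, of "- u $ l"] False show ?thesis by (simp add: algebra_simps)
      qed
    qed
    obtain i where i: "u $ i \<noteq> 0" using u(1) by (metis vec_eq_iff zero_index)
    have "0 < (\<Sum>l\<in>UNIV. \<bar>u $ l\<bar>)" using i by (intro sum_pos2[of _ i]) auto
    also have "\<dots> \<le> (\<Sum>l\<in>UNIV. u $ l * (rvec w $ l - rvec y $ l))" by (intro sum_mono comp)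
    also have "\<dots> = u \<bullet> rvec w - u \<bullet> rvec y"
      by (simp add: inner_vec_def sum_subtractf algebra_simps)
    finally show "rvec w \<notin> Q" using u by force
  qed
qed

text \<open>
  By \<open>separating_sign_direction\<close>, a boundary block has a sign vector \<open>e\<close> such that no block two or more
  steps further in direction \<open>e\<close> is a boundary block. Hence two boundary blocks with the same \<open>e\<close> on
  the same line in direction \<open>e\<close> are adjacent; the map \<open>\<psi>\<close> below records the line and the parity of the
  position on it.
\<close>

definition boundary_blocks :: "int ^ 'd \<Rightarrow> int \<Rightarrow> (real ^ 'd) set \<Rightarrow> (int ^ 'd) set" where
  "boundary_blocks t m Q = {z. (\<forall>l. \<bar>z $ l\<bar> \<le> m) \<and>
     (\<exists>w\<in>block t t z. rvec w \<in> Q) \<and> (\<exists>y\<in>block t t z. rvec y \<notin> Q)}"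

lemma card_boundary_blocks:
  fixes Q :: "(real ^ 'd) set"
  assumes Q: "convex Q" and t: "\<And>l. 0 < t $ l" and m: "0 \<le> m"
  shows "card (boundary_blocks t m Q) \<le> 3 ^ CARD('d) * (2 * nat (4 * m + 1) ^ (CARD('d) - 1))"
proof -
  let ?Z = "boundary_blocks t m Q"
  define Ze where "Ze e = {z \<in> ?Z. \<forall>j\<ge>2. (\<chi> l. z $ l + j * e $ l) \<notin> ?Z}" for e :: "int ^ 'd"
  define E where "E = {e :: int ^ 'd. \<forall>l. e $ l \<in> {-1, 1}}"
  have E_sub: "E \<subseteq> {-1..1}" proof
    fix e assume "e \<in> E"
    then have el: "e $ l = -1 \<or> e $ l = 1" for l by (auto simp: E_def)
    have "-1 \<le> e $ l \<and> e $ l \<le> 1" for l using el[of l] by linarith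
    then show "e \<in> {-1..1}" by (simp add: less_eq_vec_def)
  qed
  have fE: "finite E" using E_sub finite_lattice_interval finite_subset by blast
  \<comment> \<open>Crude bound for the 2^d sign vectors by the 3^d lattice points of the
    surrounding cube.\<close>
  have "card E \<le> card {-1..1::int ^ 'd}" by (intro card_mono finite_lattice_interval E_sub)
  also have "\<dots> = 3 ^ CARD('d)" by (simp add: card_lattice_interval)
  finally have cE: "card E \<le> 3 ^ CARD('d)" .
  have cov: "?Z \<subseteq> (\<Union>e\<in>E. Ze e)"
  proof
    fix z assume z: "z \<in> ?Z"
    then obtain y where y: "y \<in> block t t z" "rvec y \<notin> Q" by (auto simp: boundary_blocks_def)
    obtain e where "\<And>l. e $ l \<in> {-1, 1}"
      "\<And>j w. 2 \<le> j \<Longrightarrow> w \<in> block t t (\<chi> l. z $ l + j * e $ l) \<Longrightarrow> rvec w \<notin> Q"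
      using separating_sign_direction[OF Q t y] by blast
    then have "e \<in> E" "z \<in> Ze e" using z unfolding E_def Ze_def boundary_blocks_def by blast+
    then show "z \<in> (\<Union>e\<in>E. Ze e)" by blast
  qed
  fix l0 :: 'd
  have Ze_le: "finite (Ze e) \<and> card (Ze e) \<le> 2 * nat (4 * m + 1) ^ (CARD('d) - 1)" if e: "e \<in> E" for e
  proof -
    \<comment> \<open>The components at \<open>l \<noteq> l0\<close> are invariant under adding
      multiples of \<open>e\<close>, because \<open>e $ l0 * e $ l0 = 1\<close>.\<close>
    define \<psi> where "\<psi> z = (\<chi> l. if l = l0 then z $ l0 mod 2 else z $ l - e $ l * e $ l0 * z $ l0)"
      for z :: "int ^ 'd"
    \<comment> \<open>A sum or difference of two coordinates bounded by \<open>m\<close> is at most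
      \<open>2 * m\<close> in modulus: \<open>4 * m + 1\<close> values off \<open>l0\<close>, and
      two parities at \<open>l0\<close>.\<close>
    define a b :: "int ^ 'd" where "a = (\<chi> l. if l = l0 then 0 else - 2 * m)"
      and "b = (\<chi> l. if l = l0 then 1 else 2 * m)"
    have el: "e $ l = 1 \<or> e $ l = -1" for l using e by (auto simp: E_def)
    have ee: "e $ l * e $ l = 1" for l using el[of l] by auto
    have inj: "inj_on \<psi> (Ze e)"
    proof (rule inj_onI)
      fix z z' assume z: "z \<in> Ze e" and z': "z' \<in> Ze e" and eq: "\<psi> z = \<psi> z'"
      define j where "j = e $ l0 * (z' $ l0 - z $ l0)"
      have comps: "\<psi> z $ l = \<psi> z' $ l" for l using eq by simp
      have zl: "z' $ l = z $ l + j * e $ l" for l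
      proof (cases "l = l0")
        case True
        have "j * e $ l0 = (e $ l0 * e $ l0) * (z' $ l0 - z $ l0)" by (simp add: j_def)
        then show ?thesis by (simp add: ee True)
      next
        case False
        with comps[of l] show ?thesis by (simp add: \<psi>_def j_def algebra_simps)
      qed
      \<comment> \<open>Two points with the same image differ by an even multiple of
        \<open>e\<close>. A nonzero one has modulus at least 2, and then membership of one point in
        \<open>Ze e\<close> excludes the other.\<close>
      have "even (z' $ l0 - z $ l0)" using comps[of l0] by (simp add: \<psi>_def) presburger
      then have "even j" by (simp add: j_def)
      then consider "j = 0" | "j \<ge> 2" | "- j \<ge> 2" by fastforce
      then show "z = z'"
      proof cases
        case 1 then show ?thesis using zl by (simp add: vec_eq_iff)
      next
        case 2
        have "z' = (\<chi> l. z $ l + j * e $ l)" by (simp add: vec_eq_iff zl)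
        with 2 z z' show ?thesis by (auto simp: Ze_def)
      next
        case 3
        have "z = (\<chi> l. z' $ l + (- j) * e $ l)" by (simp add: vec_eq_iff zl)
        with 3 z z' show ?thesis unfolding Ze_def by blast
      qed
    qed
    have img: "\<psi> ` Ze e \<subseteq> {a..b}"
    proof -
      have "a $ l \<le> \<psi> z $ l \<and> \<psi> z $ l \<le> b $ l" if z: "z \<in> Ze e" for z l
      proof -
        have "\<bar>z $ l\<bar> \<le> m" "\<bar>z $ l0\<bar> \<le> m" using z by (auto simp: Ze_def boundary_blocks_def)
        moreover have "e $ l * e $ l0 = 1 \<or> e $ l * e $ l0 = -1" using el[of l] el[of l0] by auto
        ultimately show ?thesis by (auto simp: \<psi>_def a_def b_def)
      qed
      then show ?thesis by (auto simp: less_eq_vec_def)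
    qed
    have fin: "finite (Ze e)" 
      by (rule finite_imageD[OF finite_subset[OF img finite_lattice_interval] inj])
    have "card (Ze e) \<le> card {a..b}" by (rule card_inj_on_le[OF inj img finite_lattice_interval])
    also have "\<dots> = (\<Prod>l\<in>UNIV. if l = l0 then 2 else nat (4 * m + 1))"
      unfolding card_lattice_interval by (intro prod.cong) (auto simp: a_def b_def)
    also have "\<dots> = 2 * (\<Prod>l\<in>UNIV - {l0}. if l = l0 then 2 else nat (4 * m + 1))"
      by (subst prod.remove[of _ l0]) auto
    also have "(\<Prod>l\<in>UNIV - {l0}. if l = l0 then 2 else nat (4 * m + 1))
        = (\<Prod>l\<in>UNIV - {l0}. nat (4 * m + 1))" by (intro prod.cong) auto
    also have "\<dots> = nat (4 * m + 1) ^ (CARD('d) - 1)" by (simp add: card_Diff_singleton)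
    finally show ?thesis using fin by simp
  qed
  have "card ?Z \<le> card (\<Union>e\<in>E. Ze e)" by (intro card_mono cov finite_UN_I fE) (use Ze_le in auto)
  also have "\<dots> \<le> (\<Sum>e\<in>E. card (Ze e))" by (rule card_UN_le[OF fE])
  also have "\<dots> \<le> (\<Sum>e\<in>E. 2 * nat (4 * m + 1) ^ (CARD('d) - 1))" by (intro sum_mono) (use Ze_le in auto)
  also have "\<dots> \<le> 3 ^ CARD('d) * (2 * nat (4 * m + 1) ^ (CARD('d) - 1))" using cE by simp
  finally show ?thesis .
qed

section \<open>Convergence in distribution from Laplace transforms\<close>

lemma borel_measurable_vec:
  fixes f :: "'a \<Rightarrow> real ^ 'g"
  assumes "\<And>g. (\<lambda>\<omega>. f \<omega> $ g) \<in> borel_measurable M"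
  shows "f \<in> borel_measurable M"
  by (subst borel_measurable_euclidean_space) (use assms in \<open>auto simp: Basis_vec_def inner_axis\<close>)

lemma abs_integral_le:
  fixes f h :: "'a \<Rightarrow> real"
  assumes "integrable M f" "integrable M h" "\<And>\<omega>. \<bar>f \<omega>\<bar> \<le> h \<omega>"
  shows "\<bar>\<integral>\<omega>. f \<omega> \<partial>M\<bar> \<le> (\<integral>\<omega>. h \<omega> \<partial>M)"
proof -
  have "(\<integral>\<omega>. \<bar>f \<omega>\<bar> \<partial>M) \<le> (\<integral>\<omega>. h \<omega> \<partial>M)"
    by (intro integral_mono integrable_abs assms)
  with integral_abs_bound[of M f] show ?thesis by linarith
qed

text \<open>Polynomials in the coordinates, generated from monomials by addition so that closure
  under products and continuity are inductions. This is the function algebra for Stone-Weierstrass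
  on the unit cube.\<close>

inductive_set monomial_span :: "(real ^ 'g \<Rightarrow> real) set" where
  monomial: "(\<lambda>v. a * (\<Prod>g\<in>UNIV. v $ g ^ j g)) \<in> monomial_span"
| add: "f \<in> monomial_span \<Longrightarrow> h \<in> monomial_span \<Longrightarrow> (\<lambda>v. f v + h v) \<in> monomial_span"

lemma monomial_span_mult:
  assumes "f \<in> monomial_span" "h \<in> monomial_span"
  shows "(\<lambda>v. f v * h v) \<in> monomial_span"
  using assms(1)
proof induction
  case (monomial a j)
  from assms(2) show ?case
  proof induction
    case (monomial a' j')
    have "(\<lambda>v. (a * (\<Prod>g\<in>UNIV. v $ g ^ j g)) * (a' * (\<Prod>g\<in>UNIV. v $ g ^ j' g)))
        = (\<lambda>v. (a * a') * (\<Prod>g\<in>UNIV. v $ g ^ (j g + j' g)))"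
      by (simp add: power_add prod.distrib mult_ac)
    then show ?case by (metis (no_types) monomial_span.monomial)
  next
    case (add f h)
    then show ?case by (simp add: distrib_left monomial_span.add)
  qed
next
  case (add f h)
  then show ?case by (simp add: distrib_right monomial_span.add)
qed

lemma continuous_on_monomial_span: "f \<in> monomial_span \<Longrightarrow> continuous_on S f"
  by (induction rule: monomial_span.induct) (intro continuous_intros; assumption)+

lemma function_ring_on_monomial_span:
  fixes S :: "(real ^ 'g) set"
  assumes "compact S"
  shows "function_ring_on monomial_span S"
proof
  fix c :: real
  show "(\<lambda>_. c) \<in> monomial_span"
    using monomial_span.monomial[of c "\<lambda>_. 0"] by simp
next
  fix x y :: "real ^ 'g" assume "x \<noteq> y"
  then obtain g where g: "x $ g \<noteq> y $ g" by (metis vec_eq_iff)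
  have "(\<Prod>i\<in>UNIV. v $ i ^ (if i = g then 1 else 0)) = v $ g" for v :: "real ^ 'g"
    by (subst prod.remove[of _ g]) (auto intro!: prod.neutral)
  then have "(\<lambda>v. v $ g) \<in> monomial_span"
    using monomial_span.monomial[of 1 "\<lambda>i. if i = g then 1 else 0"] by simp
  with g show "\<exists>f\<in>monomial_span. f x \<noteq> f y" by (intro bexI[of _ "\<lambda>v. v $ g"]) auto
qed (use assms continuous_on_monomial_span monomial_span_mult monomial_span.add in auto)

definition exp_neg :: "real ^ 'g \<Rightarrow> real ^ 'g" where
  "exp_neg y = (\<chi> g. exp (- y $ g))"

lemma continuous_on_exp_neg: "continuous_on S exp_neg"
  unfolding exp_neg_def by (intro continuous_intros)

lemma exp_neg_in_cube: "(\<And>g. 0 \<le> y $ g) \<Longrightarrow> exp_neg y \<in> cbox 0 1"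
  by (simp add: exp_neg_def mem_box_cart)

text \<open>Continuity makes \<open>h\<close> bounded on the unit cube, where
  \<open>exp_neg (Y \<omega>)\<close> always lies.\<close>

lemma integrable_exp_neg:
  fixes Y :: "'a \<Rightarrow> real ^ 'g" and h :: "real ^ 'g \<Rightarrow> real"
  assumes "prob_space M" and [measurable]: "Y \<in> borel_measurable M"
    and "\<And>\<omega> g. 0 \<le> Y \<omega> $ g" and h: "continuous_on UNIV h"
  shows "integrable M (\<lambda>\<omega>. h (exp_neg (Y \<omega>)))"
proof -
  interpret prob_space M by fact
  have [measurable]: "h \<in> borel_measurable borel" "(exp_neg :: real ^ 'g \<Rightarrow> _) \<in> borel_measurable borel"
    by (intro borel_measurable_continuous_onI h continuous_on_exp_neg)+
  have "bounded (h ` cbox 0 1)"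
    by (intro compact_imp_bounded compact_continuous_image compact_cbox continuous_on_subset[OF h]) auto
  then obtain b where "\<forall>v\<in>cbox 0 1. \<bar>h v\<bar> \<le> b" by (auto simp: bounded_iff)
  then have "norm (h (exp_neg (Y \<omega>))) \<le> b" for \<omega> using exp_neg_in_cube[of "Y \<omega>"] assms(3) by auto
  then show ?thesis by (intro integrable_const_bound[of _ b]) auto
qed

text \<open>Vanishes as soon as some coordinate is at most 1/(m+1) and equals 1 once all are at
  least 2/(m+1).\<close>

definition cutoff :: "nat \<Rightarrow> real ^ 'g \<Rightarrow> real" where
  "cutoff m v = (\<Prod>g\<in>UNIV. max 0 (min 1 (real (Suc m) * v $ g - 1)))"

lemma continuous_on_cutoff: "continuous_on S (cutoff m)"
  unfolding cutoff_def by (intro continuous_intros)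

lemma cutoff_bounds: "0 \<le> cutoff m v" "cutoff m v \<le> 1"
  unfolding cutoff_def by (auto intro!: prod_nonneg prod_le_1)

lemma cutoff_tendsto:
  assumes "\<And>g. 0 < v $ g"
  shows "(\<lambda>m. cutoff m v) \<longlonglongrightarrow> 1"
proof -
  have "(\<lambda>m. max 0 (min 1 (real (Suc m) * v $ g - 1))) \<longlonglongrightarrow> 1" for g
  proof (rule tendsto_eventually)
    have "filterlim (\<lambda>m. v $ g * real (Suc m)) at_top sequentially"
      by (intro filterlim_tendsto_pos_mult_at_top[OF tendsto_const assms]
          filterlim_compose[OF filterlim_real_sequentially filterlim_Suc])
    then have "eventually (\<lambda>m. 2 \<le> v $ g * real (Suc m)) sequentially"
      by (simp add: filterlim_at_top)
    then show "eventually (\<lambda>m. max 0 (min 1 (real (Suc m) * v $ g - 1)) = 1) sequentially"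
      by eventually_elim (simp add: mult.commute)
  qed
  then have "(\<lambda>m. cutoff m v) \<longlonglongrightarrow> (\<Prod>g\<in>(UNIV :: 'a set). 1)"
    unfolding cutoff_def by (intro tendsto_prod)
  then show ?thesis by simp
qed

text \<open>
  Under \<open>exp_neg\<close> the Laplace transforms at integer points become the mixed moments of a random
  vector in the unit cube, where polynomials are uniformly dense; the cutoff keeps away from the
  faces \<open>v $ g = 0\<close>, which correspond to infinity.
\<close>

lemma converges_in_distribution_laplace:
  fixes X :: "nat \<Rightarrow> 'a \<Rightarrow> real ^ 'g" and Y :: "'c \<Rightarrow> real ^ 'g"
  assumes M: "prob_space M" and N: "prob_space N"
    and X[measurable]: "\<And>n. X n \<in> borel_measurable M" and Y[measurable]: "Y \<in> borel_measurable N"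
    and X_nonneg: "\<And>n \<omega> g. 0 \<le> X n \<omega> $ g" and Y_nonneg: "\<And>\<omega> g. 0 \<le> Y \<omega> $ g"
    and lim: "\<And>j :: 'g \<Rightarrow> nat. (\<lambda>n. \<integral>\<omega>. exp (- (\<Sum>g\<in>UNIV. real (j g) * X n \<omega> $ g)) \<partial>M)
      \<longlonglongrightarrow> (\<integral>\<omega>. exp (- (\<Sum>g\<in>UNIV. real (j g) * Y \<omega> $ g)) \<partial>N)"
  shows "converges_in_distribution M X N Y"
proof -
  interpret M: prob_space M by fact
  interpret N: prob_space N by fact
  interpret F: function_ring_on monomial_span "cbox 0 (1 :: real ^ 'g)"
    by (intro function_ring_on_monomial_span compact_cbox)
  note int_X = integrable_exp_neg[OF M X X_nonneg] and int_Y = integrable_exp_neg[OF N Y Y_nonneg]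
  have mom: "(\<Prod>g\<in>UNIV. exp_neg y $ g ^ j g) = exp (- (\<Sum>g\<in>UNIV. real (j g) * y $ g))"
    for y :: "real ^ 'g" and j
    by (simp add: exp_neg_def exp_sum flip: exp_of_nat_mult sum_negf)
  have poly: "(\<lambda>n. \<integral>\<omega>. h (exp_neg (X n \<omega>)) \<partial>M) \<longlonglongrightarrow> (\<integral>\<omega>. h (exp_neg (Y \<omega>)) \<partial>N)"
    if "h \<in> monomial_span" for h
    using that
  proof induction
    case (monomial a j)
    show ?case unfolding mom by (simp add: tendsto_mult_left lim)
  next
    case (add f h)
    note c = continuous_on_monomial_span[OF add(1)] continuous_on_monomial_span[OF add(2)]
    show ?case using tendsto_add[OF add(3,4)] by (simp add: int_X[OF c(1)] int_X[OF c(2)] int_Y[OF c(1)] int_Y[OF c(2)])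
  qed
  have cont: "(\<lambda>n. \<integral>\<omega>. h (exp_neg (X n \<omega>)) \<partial>M) \<longlonglongrightarrow> (\<integral>\<omega>. h (exp_neg (Y \<omega>)) \<partial>N)"
    if h: "continuous_on UNIV h" for h :: "real ^ 'g \<Rightarrow> real"
  proof (rule LIMSEQ_I)
    fix e :: real assume e: "0 < e"
    obtain p where p: "p \<in> monomial_span" "\<forall>v\<in>cbox 0 1. \<bar>h v - p v\<bar> < e / 3"
      using F.Stone_Weierstrass_basic[OF continuous_on_subset[OF h], of "e / 3"] e by auto
    have cp: "continuous_on UNIV p" by (rule continuous_on_monomial_span[OF p(1)])
    have close: "\<bar>(\<integral>\<omega>. h (exp_neg (Z \<omega>)) \<partial>P) - (\<integral>\<omega>. p (exp_neg (Z \<omega>)) \<partial>P)\<bar> \<le> e / 3"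
      if "prob_space P" "Z \<in> borel_measurable P" "\<And>\<omega> g. 0 \<le> Z \<omega> $ g"
      for P :: "'z measure" and Z :: "'z \<Rightarrow> real ^ 'g"
    proof -
      interpret P: prob_space P by fact
      note int = integrable_exp_neg[OF that]
      have "\<bar>\<integral>\<omega>. h (exp_neg (Z \<omega>)) - p (exp_neg (Z \<omega>)) \<partial>P\<bar> \<le> (\<integral>\<omega>. e / 3 \<partial>P)"
        by (intro abs_integral_le Bochner_Integration.integrable_diff int h cp)
          (use p(2) exp_neg_in_cube[OF that(3)] in \<open>auto intro!: less_imp_le\<close>)
      then show ?thesis by (simp add: int h cp P.prob_space)
    qed
    obtain n0 where n0: "\<forall>n\<ge>n0. norm ((\<integral>\<omega>. p (exp_neg (X n \<omega>)) \<partial>M) - (\<integral>\<omega>. p (exp_neg (Y \<omega>)) \<partial>N)) < e / 3"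
      using LIMSEQ_D[OF poly[OF p(1)], of "e / 3"] e by auto
    have "norm ((\<integral>\<omega>. h (exp_neg (X n \<omega>)) \<partial>M) - (\<integral>\<omega>. h (exp_neg (Y \<omega>)) \<partial>N)) < e" if "n \<ge> n0" for n
      using n0[rule_format, OF that] close[OF M X X_nonneg, of n] close[OF N Y Y_nonneg]
      unfolding real_norm_def by linarith
    then show "\<exists>n0. \<forall>n\<ge>n0. norm ((\<integral>\<omega>. h (exp_neg (X n \<omega>)) \<partial>M) - (\<integral>\<omega>. h (exp_neg (Y \<omega>)) \<partial>N)) < e"
      by blast
  qed
  have "(\<lambda>n. \<integral>\<omega>. f (X n \<omega>) \<partial>M) \<longlonglongrightarrow> (\<integral>\<omega>. f (Y \<omega>) \<partial>N)"
    if f: "continuous_on UNIV f" and bdd: "bounded (range f)" for f :: "real ^ 'g \<Rightarrow> real"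
  proof (rule LIMSEQ_I)
    fix e :: real assume e: "0 < e"
    have f_meas[measurable]: "f \<in> borel_measurable borel" by (rule borel_measurable_continuous_onI[OF f])
    obtain b where b: "0 < b" "\<And>v. \<bar>f v\<bar> \<le> b" using bdd unfolding bounded_pos by auto
    \<comment> \<open>A test function read through the inverse of \<open>exp_neg\<close>. The
      maximum keeps the logarithm continuous up to the faces of the cube, and wherever it changes a
      coordinate the cutoff vanishes.\<close>
    define h where "h m v = f (\<chi> g. - ln (max (v $ g) (1 / real (Suc m)))) * cutoff m v" for m v
    have "max u (1 / real (Suc m)) \<noteq> 0" for u m
      by (metis less_max_iff_disj less_numeral_extra(3) of_nat_0_less_iff zero_less_Suc zero_less_divide_1_iff)
    then have ch: "continuous_on UNIV (h m)" for m
      unfolding h_def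
      by (intro continuous_on_mult continuous_on_cutoff continuous_on_compose2[OF f] continuous_intros)
        (auto simp del: of_nat_Suc)
    have h_eq: "h m (exp_neg y) = f y * cutoff m (exp_neg y)" for m y
    proof (cases "\<exists>g. exp_neg y $ g \<le> 1 / real (Suc m)")
      case True
      then obtain g where "exp_neg y $ g \<le> 1 / real (Suc m)" ..
      then have "exp_neg y $ g * real (Suc m) \<le> 1" by (simp add: pos_le_divide_eq del: of_nat_Suc)
      then have "real (Suc m) * exp_neg y $ g - 1 \<le> 0" by (simp add: mult.commute del: of_nat_Suc)
      then have "max 0 (min 1 (real (Suc m) * exp_neg y $ g - 1)) = 0" by simp
      then have "cutoff m (exp_neg y) = 0" unfolding cutoff_def
        by (intro prod_zero) (auto simp del: of_nat_Suc)
      then show ?thesis by (simp add: h_def)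
    next
      case False
      then have "max (exp_neg y $ g) (1 / real (Suc m)) = exp_neg y $ g" for g
        by (meson linorder_not_le max_absorb1 order_less_imp_le)
      then have "(\<chi> g. - ln (max (exp_neg y $ g) (1 / real (Suc m)))) = y"
        by (simp add: vec_eq_iff exp_neg_def)
      then show ?thesis by (simp add: h_def)
    qed
    \<comment> \<open>The expected defect of the cutoff plays the part of a tail
      probability.\<close>
    have close: "\<bar>(\<integral>\<omega>. f (Z \<omega>) \<partial>P) - (\<integral>\<omega>. h m (exp_neg (Z \<omega>)) \<partial>P)\<bar>
        \<le> b * (1 - (\<integral>\<omega>. cutoff m (exp_neg (Z \<omega>)) \<partial>P))"
      if "prob_space P" "Z \<in> borel_measurable P" "\<And>\<omega> g. 0 \<le> Z \<omega> $ g"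
      for P :: "'z measure" and Z :: "'z \<Rightarrow> real ^ 'g" and m
    proof -
      interpret P: prob_space P by fact
      note int = integrable_exp_neg[OF that]
      have [measurable]: "Z \<in> borel_measurable P" by fact
      have intf: "integrable P (\<lambda>\<omega>. f (Z \<omega>))" by (intro P.integrable_const_bound[of _ b]) (use b in auto)
      have intc: "integrable P (\<lambda>\<omega>. cutoff m (exp_neg (Z \<omega>)))" by (rule int[OF continuous_on_cutoff])
      have pw: "\<bar>f (Z \<omega>) - h m (exp_neg (Z \<omega>))\<bar> \<le> b * (1 - cutoff m (exp_neg (Z \<omega>)))" for \<omega>
      proof -
        have "f (Z \<omega>) - h m (exp_neg (Z \<omega>)) = f (Z \<omega>) * (1 - cutoff m (exp_neg (Z \<omega>)))"
          by (simp add: h_eq algebra_simps)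
        then show ?thesis using b(2)[of "Z \<omega>"] cutoff_bounds(2)[of m "exp_neg (Z \<omega>)"]
          by (simp add: abs_mult mult_right_mono)
      qed
      have "\<bar>\<integral>\<omega>. f (Z \<omega>) - h m (exp_neg (Z \<omega>)) \<partial>P\<bar> \<le> (\<integral>\<omega>. b * (1 - cutoff m (exp_neg (Z \<omega>))) \<partial>P)"
        by (intro abs_integral_le pw Bochner_Integration.integrable_diff int intf ch
            Bochner_Integration.integrable_mult_right intc) auto
      then show ?thesis by (simp add: int[OF ch] intf intc P.prob_space)
    qed
    have "(\<lambda>m. \<integral>\<omega>. cutoff m (exp_neg (Y \<omega>)) \<partial>N) \<longlonglongrightarrow> (\<integral>\<omega>. 1 \<partial>N)"
    proof (rule integral_dominated_convergence[where w = "\<lambda>_. 1"])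
      show "AE \<omega> in N. (\<lambda>m. cutoff m (exp_neg (Y \<omega>))) \<longlonglongrightarrow> 1"
        by (intro AE_I2 cutoff_tendsto) (simp add: exp_neg_def)
      show "(\<lambda>\<omega>. cutoff m (exp_neg (Y \<omega>))) \<in> borel_measurable N" for m
        by (rule borel_measurable_integrable[OF int_Y[OF continuous_on_cutoff]])
      show "AE \<omega> in N. norm (cutoff m (exp_neg (Y \<omega>))) \<le> 1" for m
        by (intro AE_I2) (simp add: abs_of_nonneg cutoff_bounds)
    qed auto
    then have "(\<lambda>m. \<integral>\<omega>. cutoff m (exp_neg (Y \<omega>)) \<partial>N) \<longlonglongrightarrow> 1" by (simp add: N.prob_space)
    then have "eventually (\<lambda>m. 1 - e / (4 * b) < (\<integral>\<omega>. cutoff m (exp_neg (Y \<omega>)) \<partial>N)) sequentially"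
      by (rule order_tendstoD) (use e b in auto)
    then obtain m where m: "1 - e / (4 * b) < (\<integral>\<omega>. cutoff m (exp_neg (Y \<omega>)) \<partial>N)"
      by (auto simp: eventually_sequentially)
    \<comment> \<open>Tightness: the cutoff is itself continuous on the cube, so its expectations
      converge and the \<open>m\<close> chosen for the limit also serves \<open>X n\<close> for
      large \<open>n\<close>.\<close>
    have "eventually (\<lambda>n. 1 - e / (4 * b) < (\<integral>\<omega>. cutoff m (exp_neg (X n \<omega>)) \<partial>M)) sequentially"
      by (rule order_tendstoD(1)[OF cont[OF continuous_on_cutoff] m])
    moreover have "eventually (\<lambda>n. dist (\<integral>\<omega>. h m (exp_neg (X n \<omega>)) \<partial>M) (\<integral>\<omega>. h m (exp_neg (Y \<omega>)) \<partial>N) < e / 4) sequentially"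
      using tendstoD[OF cont[OF ch], of "e / 4"] e by simp
    ultimately have "eventually (\<lambda>n. norm ((\<integral>\<omega>. f (X n \<omega>) \<partial>M) - (\<integral>\<omega>. f (Y \<omega>) \<partial>N)) < e) sequentially"
    proof eventually_elim
      case (elim n)
      have small: "b * (1 - r) < e / 4" if "1 - e / (4 * b) < r" for r
      proof -
        have "b * (1 - r) < b * (e / (4 * b))" using that b by (intro mult_strict_left_mono) auto
        then show ?thesis using b by simp
      qed
      show ?case
        using close[OF M X X_nonneg, of n m] close[OF N Y Y_nonneg, of m]
          small[OF m] small[OF elim(1)] elim(2) unfolding real_norm_def dist_real_def by linarith
    qed
    then show "\<exists>n0. \<forall>n\<ge>n0. norm ((\<integral>\<omega>. f (X n \<omega>) \<partial>M) - (\<integral>\<omega>. f (Y \<omega>) \<partial>N)) < e"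
      by (simp add: eventually_sequentially)
  qed
  then show ?thesis
    unfolding converges_in_distribution_def weakly_converges_def
    by (simp add: integral_distr borel_measurable_continuous_onI)
qed

section \<open>Void probabilities of stationary fields\<close>

locale stationary_prob_field = prob_space M for M :: "'a measure" +
  fixes \<xi> :: "int ^ 'd \<Rightarrow> 'a \<Rightarrow> real"
  assumes meas[measurable]: "\<And>v. \<xi> v \<in> borel_measurable M"
    and stat: "stationary_field M \<xi>"
begin

definition void :: "real \<Rightarrow> (int ^ 'd) set \<Rightarrow> real" where
  "void x A = prob {\<omega> \<in> space M. \<forall>v\<in>A. \<xi> v \<omega> \<le> x}"

definition void_ind :: "real \<Rightarrow> (int ^ 'd) set \<Rightarrow> 'a \<Rightarrow> real" where
  "void_ind x A \<omega> = (if \<forall>v\<in>A. \<xi> v \<omega> \<le> x then 1 else 0)"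

definition exc :: "real \<Rightarrow> real" where
  "exc x = prob {\<omega> \<in> space M. x < \<xi> 0 \<omega>}"

definition count :: "real \<Rightarrow> (int ^ 'd) set \<Rightarrow> 'a \<Rightarrow> real" where
  "count x A \<omega> = (\<Sum>v\<in>A. indicat_real {x<..} (\<xi> v \<omega>))"

lemma max_field_le: "\<P>(\<omega> in M. max_field \<xi> A \<omega> \<le> ereal x) = void x A"
  by (simp add: void_def max_field_def SUP_le_iff)

lemma stationary_prob:
  assumes "{f. P f} \<in> sets (Pi\<^sub>M UNIV (\<lambda>_. borel :: real measure))"
  shows "prob {\<omega> \<in> space M. P (\<lambda>v. \<xi> (v + w) \<omega>)} = prob {\<omega> \<in> space M. P (\<lambda>v. \<xi> v \<omega>)}"
proof -
  have m: "(\<lambda>\<omega> v. \<xi> (v + w) \<omega>) \<in> M \<rightarrow>\<^sub>M Pi\<^sub>M UNIV (\<lambda>_. borel)" for w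
    by (intro measurable_PiM_single') (auto simp: space_PiM)
  have "prob {\<omega> \<in> space M. P (\<lambda>v. \<xi> (v + w) \<omega>)}
      = measure (distr M (Pi\<^sub>M UNIV (\<lambda>_. borel)) (\<lambda>\<omega> v. \<xi> (v + w) \<omega>)) {f. P f}" for w
    by (subst measure_distr[OF m assms]) (auto intro!: arg_cong[of _ _ prob])
  from this[of w] this[of 0] show ?thesis using stat by (simp add: stationary_field_def)
qed

lemma prob_exceeds: "prob {\<omega> \<in> space M. x < \<xi> v \<omega>} = exc x"
proof -
  have "{f. x < f (0 :: int ^ 'd)} = {f \<in> space (Pi\<^sub>M UNIV (\<lambda>_. borel :: real measure)). x < f 0}"
    by (simp add: space_PiM)
  also have "\<dots> \<in> sets (Pi\<^sub>M UNIV (\<lambda>_. borel))" by measurable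
  finally show ?thesis using stationary_prob[of "\<lambda>f. x < f 0" v] by (simp add: exc_def)
qed

lemma void_translate:
  assumes "finite A"
  shows "void x ((\<lambda>v. v + w) ` A) = void x A"
proof -
  have "{f. \<forall>v\<in>A. f v \<le> x} = {f \<in> space (Pi\<^sub>M UNIV (\<lambda>_. borel :: real measure)). \<forall>v\<in>A. f v \<le> x}"
    by (simp add: space_PiM)
  also have "\<dots> \<in> sets (Pi\<^sub>M UNIV (\<lambda>_. borel))" using assms by measurable
  finally show ?thesis using stationary_prob[of "\<lambda>f. \<forall>v\<in>A. f v \<le> x" w] by (simp add: void_def)
qed

lemma void_bounds: "0 \<le> void x A" "void x A \<le> 1"
  by (simp_all add: void_def)

lemma borel_measurable_void_ind[measurable]: "finite A \<Longrightarrow> void_ind x A \<in> borel_measurable M"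
  unfolding void_ind_def[abs_def] by measurable

lemma borel_measurable_count[measurable]: "count x A \<in> borel_measurable M"
  unfolding count_def[abs_def] by measurable

lemma void_ind_bounds: "0 \<le> void_ind x A \<omega>" "void_ind x A \<omega> \<le> 1"
  by (simp_all add: void_ind_def)

lemma integrable_void_ind: "finite A \<Longrightarrow> integrable M (void_ind x A)"
  by (intro integrable_const_bound[of _ 1]) (auto simp: void_ind_def)

lemma expectation_void_ind:
  assumes "finite A"
  shows "expectation (void_ind x A) = void x A"
proof -
  have "expectation (void_ind x A) = expectation (indicat_real {\<omega> \<in> space M. \<forall>v\<in>A. \<xi> v \<omega> \<le> x})"
    by (intro Bochner_Integration.integral_cong) (auto simp: void_ind_def indicator_def)
  also have "\<dots> = void x A" by (simp add: void_def Int_absorb2)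
  finally show ?thesis .
qed

lemma integrable_count: "integrable M (count x A)"
  unfolding count_def[abs_def]
  by (intro Bochner_Integration.integrable_sum integrable_const_bound[of _ 1]) auto

lemma expectation_count: "expectation (count x A) = card A * exc x"
proof -
  have "expectation (\<lambda>\<omega>. indicat_real {x<..} (\<xi> v \<omega>)) = exc x" for v
  proof -
    have "expectation (\<lambda>\<omega>. indicat_real {x<..} (\<xi> v \<omega>))
        = expectation (indicat_real {\<omega> \<in> space M. x < \<xi> v \<omega>})"
      by (intro Bochner_Integration.integral_cong) (auto simp: indicator_def)
    then show ?thesis by (simp add: prob_exceeds Int_absorb2)
  qed
  moreover have "integrable M (\<lambda>\<omega>. indicat_real {x<..} (\<xi> v \<omega>))" for v
    by (intro integrable_const_bound[of _ 1]) auto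
  ultimately show ?thesis by (simp add: count_def[abs_def])
qed

lemma one_minus_void_ind_le_count:
  assumes "finite A"
  shows "1 - void_ind x A \<omega> \<le> count x A \<omega>"
proof (cases "\<forall>v\<in>A. \<xi> v \<omega> \<le> x")
  case True
  then show ?thesis by (simp add: void_ind_def count_def sum_nonneg)
next
  case False
  then obtain v where v: "v \<in> A" "x < \<xi> v \<omega>" by (auto simp: not_le)
  then have "indicat_real {x<..} (\<xi> v \<omega>) \<le> count x A \<omega>"
    unfolding count_def using assms by (intro member_le_sum) auto
  with v False show ?thesis by (auto simp: void_ind_def)
qed

lemma one_minus_void_le: "finite A \<Longrightarrow> 1 - void x A \<le> card A * exc x"
  using integral_mono[of M "\<lambda>\<omega>. 1 - void_ind x A \<omega>" "count x A"] one_minus_void_ind_le_count[of A x]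
  by (simp add: integrable_void_ind integrable_count expectation_void_ind expectation_count prob_space)

text \<open>Decomposes according to the largest point of \<open>J\<close> at which there is an exceedance.\<close>

lemma one_minus_void_ge:
  assumes R: "linear_order R" and fin: "finite J" "finite A"
    and A: "\<And>v w. v \<in> J \<Longrightarrow> w \<in> J \<Longrightarrow> (v, w) \<in> R \<Longrightarrow> v \<noteq> w \<Longrightarrow> w - v \<in> A"
  shows "card J * prob {\<omega> \<in> space M. (\<forall>z\<in>A. \<xi> z \<omega> \<le> x) \<and> x < \<xi> 0 \<omega>} \<le> 1 - void x J"
proof -
  let ?q = "prob {\<omega> \<in> space M. (\<forall>z\<in>A. \<xi> z \<omega> \<le> x) \<and> x < \<xi> 0 \<omega>}"
  define E where "E v = {\<omega> \<in> space M. (\<forall>z\<in>A. \<xi> (z + v) \<omega> \<le> x) \<and> x < \<xi> (0 + v) \<omega>}" for v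
  have E_meas: "E v \<in> events" for v unfolding E_def using fin by measurable
  have "{f. (\<forall>z\<in>A. f z \<le> x) \<and> x < f (0 :: int ^ 'd)}
      = {f \<in> space (Pi\<^sub>M UNIV (\<lambda>_. borel :: real measure)). (\<forall>z\<in>A. f z \<le> x) \<and> x < f 0}"
    by (simp add: space_PiM)
  also have "\<dots> \<in> sets (Pi\<^sub>M UNIV (\<lambda>_. borel))" using fin by measurable
  finally have E_prob: "prob (E v) = ?q" for v
    using stationary_prob[of "\<lambda>f. (\<forall>z\<in>A. f z \<le> x) \<and> x < f 0" v] by (simp add: E_def)
  \<comment> \<open>On \<open>E v\<close> the translate of \<open>A\<close> by \<open>v\<close> is
    free of exceedances. It contains \<open>w\<close>, at which \<open>E w\<close> has one.\<close>
  have E_disj: "E v \<inter> E w = {}" if "v \<in> J" "w \<in> J" "(v, w) \<in> R" "v \<noteq> w" for v w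
    using A[OF that] by (fastforce simp: E_def)
  have "disjoint_family_on E J"
  proof (unfold disjoint_family_on_def, intro ballI impI)
    fix v w assume vw: "v \<in> J" "w \<in> J" "v \<noteq> w"
    then have "(v, w) \<in> R \<or> (w, v) \<in> R"
      using R by (auto simp: linear_order_on_def total_on_def)
    with vw E_disj[of v w] E_disj[of w v] show "E v \<inter> E w = {}" by blast
  qed
  then have "card J * ?q = prob (\<Union>v\<in>J. E v)"
    using fin E_meas by (subst finite_measure_finite_Union) (auto simp: E_prob)
  also have "\<dots> \<le> prob (space M - {\<omega> \<in> space M. \<forall>v\<in>J. \<xi> v \<omega> \<le> x})"
    using fin by (intro finite_measure_mono) (auto simp: E_def not_le)
  also have "\<dots> = 1 - void x J"
    unfolding void_def using fin by (intro prob_compl) measurable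
  finally show ?thesis .
qed

section \<open>Factorisation of void probabilities\<close>

definition mixing :: "real \<Rightarrow> (int ^ 'd) set \<Rightarrow> real ^ 'd \<Rightarrow> real \<Rightarrow> bool" where
  "mixing x K \<gamma> \<alpha> \<longleftrightarrow> (\<forall>A B. A \<subseteq> K \<longrightarrow> B \<subseteq> K \<longrightarrow> separated \<gamma> A B \<longrightarrow>
     lattice_box A \<or> lattice_box B \<longrightarrow> \<bar>void x (A \<union> B) - void x A * void x B\<bar> \<le> \<alpha>)"

text \<open>The union of the remaining blocks is no box, but the single block split off in each step
  is, so the mixing condition applies. The errors add up because earlier ones are multiplied by a
  probability.\<close>

lemma void_Union:
  fixes \<alpha> :: real
  assumes mix: "mixing x K \<gamma> \<alpha>" and "finite Z"
    and Q: "\<And>z. z \<in> Z \<Longrightarrow> Q z \<subseteq> K" "\<And>z. z \<in> Z \<Longrightarrow> lattice_box (Q z)"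
    and sep: "\<And>z z'. z \<in> Z \<Longrightarrow> z' \<in> Z \<Longrightarrow> z \<noteq> z' \<Longrightarrow> far \<gamma> (Q z) (Q z')"
  shows "\<bar>void x (\<Union>z\<in>Z. Q z) - (\<Prod>z\<in>Z. void x (Q z))\<bar> \<le> card Z * \<alpha>"
  using \<open>finite Z\<close> Q sep
proof (induction Z rule: finite_induct)
  case empty
  then show ?case by (simp add: void_def prob_space)
next
  case (insert z Z)
  let ?B = "\<Union>z\<in>Z. Q z" and ?P = "\<Prod>z\<in>Z. void x (Q z)"
  have "far \<gamma> (Q z) (Q z')" if "z' \<in> Z" for z'
    using that insert.hyps by (intro insert.prems(3)) auto
  then have "separated \<gamma> (Q z) ?B" by (intro far_imp_separated) (auto simp: far_def)
  then have 1: "\<bar>void x (Q z \<union> ?B) - void x (Q z) * void x ?B\<bar> \<le> \<alpha>"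
    using mix insert.prems(1,2) unfolding mixing_def by (metis UN_least insertCI)
  have "\<bar>void x ?B - ?P\<bar> \<le> card Z * \<alpha>" by (rule insert.IH) (use insert.prems in auto)
  then have "void x (Q z) * \<bar>void x ?B - ?P\<bar> \<le> 1 * (card Z * \<alpha>)"
    using void_bounds[of x "Q z"] by (intro mult_mono) auto
  then have 2: "\<bar>void x (Q z) * void x ?B - void x (Q z) * ?P\<bar> \<le> card Z * \<alpha>"
    using void_bounds(1)[of x "Q z"] by (simp add: abs_mult flip: right_diff_distrib)
  show ?case using 1 2 insert.hyps by (simp add: algebra_simps)
qed

text \<open>
  The product is a random mixture of indicators of void events: keep each \<open>z\<close> independently with
  probability \<open>1 - u z\<close>.
\<close>

lemma expectation_void_mixture:
  fixes \<alpha> :: real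
  assumes mix: "mixing x K \<gamma> \<alpha>" and "finite Z" and u: "\<And>z. z \<in> Z \<Longrightarrow> 0 \<le> u z" "\<And>z. z \<in> Z \<Longrightarrow> u z \<le> 1"
    and Q: "\<And>z. z \<in> Z \<Longrightarrow> Q z \<subseteq> K" "\<And>z. z \<in> Z \<Longrightarrow> lattice_box (Q z)" "\<And>z. z \<in> Z \<Longrightarrow> finite (Q z)"
    and sep: "\<And>z z'. z \<in> Z \<Longrightarrow> z' \<in> Z \<Longrightarrow> z \<noteq> z' \<Longrightarrow> far \<gamma> (Q z) (Q z')"
  shows "\<bar>expectation (\<lambda>\<omega>. \<Prod>z\<in>Z. (1 - u z) * void_ind x (Q z) \<omega> + u z)
     - (\<Prod>z\<in>Z. (1 - u z) * void x (Q z) + u z)\<bar> \<le> card Z * \<alpha>"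
proof -
  \<comment> \<open>The probability that exactly the elements of \<open>T\<close> are kept.\<close>
  define W where "W T = (\<Prod>z\<in>T. 1 - u z) * (\<Prod>z\<in>Z - T. u z)" for T
  have W_nonneg: "0 \<le> W T" if "T \<in> Pow Z" for T
    unfolding W_def using that u by (intro mult_nonneg_nonneg prod_nonneg) auto
  have W_sum: "(\<Sum>T\<in>Pow Z. W T) = 1"
    using prod_add[OF \<open>finite Z\<close>, of "\<lambda>z. 1 - u z" u] by (simp add: W_def)
  have fin_T: "finite T" if "T \<in> Pow Z" for T using that \<open>finite Z\<close> finite_subset by blast
  \<comment> \<open>Nonnegativity of \<alpha>, by testing the mixing condition on two empty sets; it
    allows \<open>card T\<close> to be replaced by \<open>card Z\<close> below.\<close>
  have alpha: "0 \<le> \<alpha>"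
  proof -
    have "\<bar>void x ({} \<union> {}) - void x {} * void x {}\<bar> \<le> \<alpha>"
      using mix lattice_box_empty far_imp_separated[of \<gamma> "{}" "{}"] far_def[of \<gamma> "{}" "{}"] unfolding mixing_def by blast
    then show ?thesis by linarith
  qed
  have ind: "(\<Prod>z\<in>T. void_ind x (Q z) \<omega>) = void_ind x (\<Union>z\<in>T. Q z) \<omega>" if "finite T" for T \<omega>
    using that by induction (auto simp: void_ind_def)
  have "expectation (\<lambda>\<omega>. \<Prod>z\<in>Z. (1 - u z) * void_ind x (Q z) \<omega> + u z)
      = expectation (\<lambda>\<omega>. \<Sum>T\<in>Pow Z. W T * void_ind x (\<Union>z\<in>T. Q z) \<omega>)"
    unfolding prod_add[OF \<open>finite Z\<close>] W_def
    by (intro Bochner_Integration.integral_cong refl sum.cong) (auto simp: prod.distrib ind fin_T)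
  also have "\<dots> = (\<Sum>T\<in>Pow Z. W T * void x (\<Union>z\<in>T. Q z))"
    using Q(3) fin_T
    by (subst Bochner_Integration.integral_sum)
      (auto intro!: sum.cong Bochner_Integration.integrable_mult_right integrable_void_ind
        simp: expectation_void_ind subset_iff)
  finally have E: "expectation (\<lambda>\<omega>. \<Prod>z\<in>Z. (1 - u z) * void_ind x (Q z) \<omega> + u z) = \<dots>" .
  \<comment> \<open>The product of the means expands over the same subsets with the same weights, so
    the comparison is made subset by subset and then averaged.\<close>
  have P: "(\<Prod>z\<in>Z. (1 - u z) * void x (Q z) + u z) = (\<Sum>T\<in>Pow Z. W T * (\<Prod>z\<in>T. void x (Q z)))"
    unfolding prod_add[OF \<open>finite Z\<close>] W_def by (simp add: prod.distrib mult_ac)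
  have "\<bar>W T * void x (\<Union>z\<in>T. Q z) - W T * (\<Prod>z\<in>T. void x (Q z))\<bar> \<le> W T * (card Z * \<alpha>)"
    if T: "T \<in> Pow Z" for T
  proof -
    have "\<bar>void x (\<Union>z\<in>T. Q z) - (\<Prod>z\<in>T. void x (Q z))\<bar> \<le> card T * \<alpha>"
      by (rule void_Union[OF mix fin_T[OF T]]) (simp_all add: Q sep subsetD[OF PowD[OF T]])
    also have "\<dots> \<le> card Z * \<alpha>"
      using T alpha \<open>finite Z\<close> by (intro mult_right_mono) (auto intro: card_mono)
    finally have "W T * \<bar>void x (\<Union>z\<in>T. Q z) - (\<Prod>z\<in>T. void x (Q z))\<bar> \<le> W T * (card Z * \<alpha>)"
      using W_nonneg[OF T] by (rule mult_left_mono)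
    then show ?thesis using W_nonneg[OF T] by (simp add: abs_mult flip: right_diff_distrib)
  qed
  then have "\<bar>\<Sum>T\<in>Pow Z. W T * void x (\<Union>z\<in>T. Q z) - W T * (\<Prod>z\<in>T. void x (Q z))\<bar>
      \<le> (\<Sum>T\<in>Pow Z. W T * (card Z * \<alpha>))"
    by (intro order_trans[OF sum_abs] sum_mono)
  also have "\<dots> = card Z * \<alpha>" by (simp add: W_sum flip: sum_distrib_right)
  finally show ?thesis unfolding E P by (simp add: sum_subtractf)
qed

end

section \<open>Laplace transforms of block counts\<close>

text \<open>For nonnegative \<open>a\<close> the numbers exp(-a) and 1 - a differ by at most a^2, so
  their m-th powers differ by at most m * a^2 once a < 1. The case \<open>r = 0\<close>, in which
  \<open>m\<close> may stay bounded, is included.\<close>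

lemma power_tendsto_exp:
  fixes a :: "nat \<Rightarrow> real" and m :: "nat \<Rightarrow> nat"
  assumes nonneg: "\<And>n. 0 \<le> a n" and a: "a \<longlonglongrightarrow> 0" and ma: "(\<lambda>n. m n * a n) \<longlonglongrightarrow> r"
  shows "(\<lambda>n. (1 - a n) ^ m n) \<longlonglongrightarrow> exp (- r)"
proof -
  have "eventually (\<lambda>n. a n < 1) sequentially" using a by (rule order_tendstoD) simp
  then have "eventually (\<lambda>n. norm (exp (- a n) ^ m n - (1 - a n) ^ m n) \<le> m n * a n * a n) sequentially"
  proof eventually_elim
    case (elim n)
    have "1 - a n \<le> exp (- a n)" using exp_ge_add_one_self[of "- a n"] by simp
    moreover have "exp (- a n) \<le> 1 - a n + a n * a n"
    proof -
      have "exp (- a n) \<le> 1 / (1 + a n)"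
        using exp_ge_add_one_self[of "a n"] nonneg[of n] by (simp add: exp_minus field_simps)
      also have "\<dots> \<le> 1 - a n + a n * a n"
      proof -
        have "1 \<le> (1 - a n + a n * a n) * (1 + a n)" using nonneg[of n] by (simp add: algebra_simps)
        then show ?thesis using nonneg[of n] by (simp add: divide_le_eq)
      qed
      finally show ?thesis .
    qed
    ultimately have "m n * norm (exp (- a n) - (1 - a n)) \<le> m n * (a n * a n)"
      by (intro mult_left_mono) auto
    moreover have "norm (exp (- a n) ^ m n - (1 - a n) ^ m n) \<le> m n * norm (exp (- a n) - (1 - a n))"
      using elim nonneg[of n] by (intro norm_power_diff) auto
    ultimately show ?case by simp
  qed
  moreover have "(\<lambda>n. m n * a n * a n) \<longlonglongrightarrow> 0" using tendsto_mult[OF ma a] by simp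
  ultimately have "(\<lambda>n. exp (- a n) ^ m n - (1 - a n) ^ m n) \<longlonglongrightarrow> 0" by (rule Lim_null_comparison)
  moreover have "(\<lambda>n. exp (- a n) ^ m n) \<longlonglongrightarrow> exp (- r)"
    using tendsto_exp[OF tendsto_minus[OF ma]] by (simp flip: exp_of_nat_mult)
  ultimately show ?thesis using tendsto_diff by fastforce
qed

text \<open>The probability generating function; evaluated at \<open>u = exp (- j)\<close> it is the
  Laplace transform at the integer \<open>j\<close>. Rate 0 is the point mass fixed in
  \<open>poisson_law\<close>.\<close>

lemma integral_poisson_law:
  assumes "0 \<le> r" "0 \<le> u" "u \<le> 1"
  shows "(\<integral>i. u ^ i \<partial>measure_pmf (poisson_law r)) = exp (- ((1 - u) * r))"
proof (cases "r = 0")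
  case True
  then show ?thesis by (simp add: poisson_law_def)
next
  case False
  then have r: "0 < r" using assms by simp
  have "(\<lambda>i. (u * r) ^ i / fact i) sums exp (u * r)"
    using exp_converges[of "u * r"] by (simp add: divide_inverse mult.commute)
  from sums_mult[OF this, of "exp (- r)"]
  have s: "(\<lambda>i. pmf (poisson_pmf r) i * u ^ i) sums (exp (- r) * exp (u * r))"
    using r by (simp add: power_mult_distrib mult_ac)
  have "integrable (count_space UNIV) (\<lambda>i. pmf (poisson_pmf r) i * u ^ i)"
    using s assms by (subst integrable_count_space_nat_iff) (simp add: abs_mult sums_iff)
  then have "(\<integral>i. pmf (poisson_pmf r) i * u ^ i \<partial>count_space UNIV) = exp (- r) * exp (u * r)"
    using s by (simp add: integral_count_space_nat sums_iff)
  then show ?thesis using False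
    by (simp add: poisson_law_def integral_measure_pmf measure_pmf_eq_density integral_density flip: exp_add)
      (simp add: algebra_simps)
qed

lemma abs_exp_neg_diff_le:
  fixes a b :: real
  assumes "0 \<le> b" "b \<le> a"
  shows "\<bar>exp (- a) - exp (- b)\<bar> \<le> a - b"
proof -
  have "exp (- b) - exp (- a) = exp (- b) * (1 - exp (b - a))"
    by (simp add: algebra_simps flip: exp_add)
  also have "\<dots> \<le> 1 * (1 - exp (b - a))"
    using assms by (intro mult_right_mono) auto
  also have "\<dots> = 1 - exp (b - a)" by simp
  also have "\<dots> \<le> 1 - (1 + (b - a))"
    by (intro diff_left_mono exp_ge_add_one_self)
  also have "\<dots> = a - b" by simp
  finally show ?thesis using assms by simp
qed

context stationary_prob_field
begin

lemma count_mono: "finite B \<Longrightarrow> A \<subseteq> B \<Longrightarrow> count x A \<omega> \<le> count x B \<omega>"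
  unfolding count_def by (intro sum_mono2) auto

text \<open>
  The number \<open>S g\<close> of blocks with an exceedance is at most the number of exceedances in \<open>B g\<close>, so that
  their distance in mean is just the difference of the means.
\<close>

lemma laplace_counts:
  fixes \<alpha> :: real and B :: "'g::finite \<Rightarrow> (int ^ 'd) set" and Z :: "'g \<Rightarrow> (int ^ 'd) set"
    and j :: "'g \<Rightarrow> nat" and p :: real
  assumes mix: "mixing x K \<gamma> \<alpha>"
    and t: "\<And>l. 0 < t $ l" and s: "\<And>l. s $ l \<le> t $ l" and \<gamma>: "\<And>l. \<bar>\<gamma> $ l\<bar> \<le> real_of_int (t $ l - s $ l)"
    and fin: "\<And>g. finite (Z g)" "\<And>g. finite (B g)" and disj: "\<And>g g'. g \<noteq> g' \<Longrightarrow> Z g \<inter> Z g' = {}"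
    and ZB: "\<And>g z. z \<in> Z g \<Longrightarrow> block t s z \<subseteq> B g" and BK: "\<And>g. B g \<subseteq> K"
  defines "p \<equiv> 1 - void x (block t s 0)"
  shows "\<bar>expectation (\<lambda>\<omega>. exp (- (\<Sum>g\<in>UNIV. j g * count x (B g) \<omega>)))
      - (\<Prod>g\<in>UNIV. (1 - (1 - exp (- real (j g))) * p) ^ card (Z g))\<bar>
    \<le> (\<Sum>g\<in>UNIV. card (Z g)) * \<alpha> + (\<Sum>g\<in>UNIV. j g * (card (B g) * exc x - card (Z g) * p))"
proof -
  define S where "S g \<omega> = (\<Sum>z\<in>Z g. 1 - void_ind x (block t s z) \<omega>)" for g \<omega>
  define u where "u = (\<lambda>(g, z :: int ^ 'd). exp (- real (j g)))"
  \<comment> \<open>Indexing by the pairs (g, z) lets a single use of the mixture lemma treat all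
    \<open>g\<close> at once; the joint factorisation over \<open>g\<close>, and with it the
    independence of the limits, comes from here.\<close>
  define Q where "Q = (\<lambda>(g :: 'g, z). block t s z)"
  let ?Z = "Sigma UNIV Z"
  have void_block: "void x (block t s z) = 1 - p" for z
    using void_translate[OF finite_block, of x "t * z" t s 0] block_translate[of t s z] by (simp add: p_def)
  have S_nonneg: "0 \<le> S g \<omega>" for g \<omega>
    unfolding S_def using void_ind_bounds(2)[of x] by (intro sum_nonneg) simp
  have S_le: "S g \<omega> \<le> count x (B g) \<omega>" for g \<omega>
  proof -
    have "S g \<omega> \<le> (\<Sum>z\<in>Z g. count x (block t s z) \<omega>)"
      unfolding S_def by (intro sum_mono one_minus_void_ind_le_count finite_block)
    also have "\<dots> = count x (\<Union>z\<in>Z g. block t s z) \<omega>"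
      unfolding count_def
      using fin block_disjoint[OF t s] by (intro sum.UNION_disjoint[symmetric]) (auto simp: finite_block)
    also have "\<dots> \<le> count x (B g) \<omega>" using ZB fin by (intro count_mono) auto
    finally show ?thesis .
  qed
  have S_int: "integrable M (S g)" for g
    unfolding S_def[abs_def]
    by (intro Bochner_Integration.integrable_sum Bochner_Integration.integrable_diff
        integrable_void_ind finite_block) auto
  have ES: "expectation (S g) = card (Z g) * p" for g
    unfolding S_def[abs_def]
    by (simp add: integrable_void_ind finite_block expectation_void_ind void_block prob_space)
  have expS_int: "integrable M (\<lambda>\<omega>. exp (- (\<Sum>g\<in>UNIV. j g * S g \<omega>)))"
    using S_int S_nonneg
    by (intro integrable_const_bound[of _ 1]) (auto intro!: sum_nonneg borel_measurable_integrable)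
  have expN_int: "integrable M (\<lambda>\<omega>. exp (- (\<Sum>g\<in>UNIV. j g * count x (B g) \<omega>)))"
    by (intro integrable_const_bound[of _ 1]) (auto simp: count_def intro!: sum_nonneg mult_nonneg_nonneg)
  have "\<bar>expectation (\<lambda>\<omega>. exp (- (\<Sum>g\<in>UNIV. j g * count x (B g) \<omega>)) - exp (- (\<Sum>g\<in>UNIV. j g * S g \<omega>)))\<bar>
      \<le> expectation (\<lambda>\<omega>. \<Sum>g\<in>UNIV. j g * (count x (B g) \<omega> - S g \<omega>))"
  proof (intro abs_integral_le)
    fix \<omega>
    have "\<bar>exp (- (\<Sum>g\<in>UNIV. j g * count x (B g) \<omega>)) - exp (- (\<Sum>g\<in>UNIV. j g * S g \<omega>))\<bar>
        \<le> (\<Sum>g\<in>UNIV. j g * count x (B g) \<omega>) - (\<Sum>g\<in>UNIV. j g * S g \<omega>)"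
      by (intro abs_exp_neg_diff_le sum_nonneg sum_mono mult_left_mono mult_nonneg_nonneg S_nonneg S_le) auto
    then show "\<bar>exp (- (\<Sum>g\<in>UNIV. j g * count x (B g) \<omega>)) - exp (- (\<Sum>g\<in>UNIV. j g * S g \<omega>))\<bar>
        \<le> (\<Sum>g\<in>UNIV. j g * (count x (B g) \<omega> - S g \<omega>))"
      by (simp add: sum_subtractf right_diff_distrib)
  qed (intro Bochner_Integration.integrable_diff expS_int expN_int Bochner_Integration.integrable_sum
      Bochner_Integration.integrable_mult_right S_int integrable_count)+
  also have "\<dots> = (\<Sum>g\<in>UNIV. j g * (card (B g) * exc x - card (Z g) * p))"
    by (simp add: S_int integrable_count expectation_count ES)
  finally have 1: "\<bar>expectation (\<lambda>\<omega>. exp (- (\<Sum>g\<in>UNIV. j g * count x (B g) \<omega>)))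
      - expectation (\<lambda>\<omega>. exp (- (\<Sum>g\<in>UNIV. j g * S g \<omega>)))\<bar> \<le> \<dots>"
    by (simp add: expN_int expS_int)
  \<comment> \<open>A function of a 0-1 variable is affine in it; the constant term
    \<open>exp (- i)\<close> becomes the probability of dropping a block.\<close>
  have exp_ind: "exp (- (i * (1 - void_ind x A \<omega>))) = (1 - exp (- i)) * void_ind x A \<omega> + exp (- i)"
    for A \<omega> and i :: real
    by (simp add: void_ind_def)
  have "exp (- (\<Sum>g\<in>UNIV. j g * S g \<omega>)) = (\<Prod>z\<in>?Z. (1 - u z) * void_ind x (Q z) \<omega> + u z)" for \<omega>
  proof -
    have "exp (- (\<Sum>g\<in>UNIV. j g * S g \<omega>))
        = (\<Prod>g\<in>UNIV. \<Prod>z\<in>Z g. exp (- (j g * (1 - void_ind x (block t s z) \<omega>))))"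
      by (simp add: S_def sum_distrib_left fin flip: exp_sum sum_negf)
    also have "\<dots> = (\<Prod>(g, z)\<in>?Z. (1 - exp (- j g)) * void_ind x (block t s z) \<omega> + exp (- j g))"
      using fin by (simp add: prod.Sigma exp_ind)
    also have "\<dots> = (\<Prod>z\<in>?Z. (1 - u z) * void_ind x (Q z) \<omega> + u z)"
      by (intro prod.cong) (auto simp: u_def Q_def)
    finally show ?thesis .
  qed
  moreover have "\<bar>expectation (\<lambda>\<omega>. \<Prod>z\<in>?Z. (1 - u z) * void_ind x (Q z) \<omega> + u z)
      - (\<Prod>z\<in>?Z. (1 - u z) * void x (Q z) + u z)\<bar> \<le> card ?Z * \<alpha>"
  proof (rule expectation_void_mixture[OF mix])
    fix z z' assume z: "z \<in> ?Z" and z': "z' \<in> ?Z" and "z \<noteq> z'"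
    \<comment> \<open>Distinct pairs have distinct block indices since the sets \<open>Z g\<close>
      are disjoint, so blocks belonging to different \<open>g\<close> are also separated.\<close>
    have "snd z \<noteq> snd z'"
    proof
      assume eq: "snd z = snd z'"
      with \<open>z \<noteq> z'\<close> have "fst z \<noteq> fst z'" by (simp add: prod_eq_iff)
      from disj[OF this] z z' eq show False by (auto simp: mem_Sigma_iff)
    qed
    show "far \<gamma> (Q z) (Q z')"
      unfolding far_def
    proof (intro ballI)
      fix v w assume "v \<in> Q z" "w \<in> Q z'"
      then have "v \<in> block t s (snd z)" "w \<in> block t s (snd z')" by (simp_all add: Q_def case_prod_beta)
      from block_gap[OF t s \<open>snd z \<noteq> snd z'\<close> this] obtain l where "t $ l - s $ l < \<bar>v $ l - w $ l\<bar>" ..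
      with \<gamma>[of l] have "\<bar>\<gamma> $ l\<bar> < real_of_int \<bar>v $ l - w $ l\<bar>" by linarith
      then show "\<exists>l. \<bar>\<gamma> $ l\<bar> < real_of_int \<bar>v $ l - w $ l\<bar>" ..
    qed
  next
    fix z assume "z \<in> ?Z"
    then show "Q z \<subseteq> K" using ZB BK by (fastforce simp: Q_def)
  qed (use fin in \<open>auto simp: u_def Q_def lattice_box_block finite_block\<close>)
  moreover have "(\<Prod>z\<in>?Z. (1 - u z) * void x (Q z) + u z)
      = (\<Prod>g\<in>UNIV. (1 - (1 - exp (- real (j g))) * p) ^ card (Z g))"
  proof -
    have "(\<Prod>z\<in>?Z. (1 - u z) * void x (Q z) + u z)
        = (\<Prod>(g, z)\<in>?Z. 1 - (1 - exp (- real (j g))) * p)"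
      by (intro prod.cong) (auto simp: u_def Q_def void_block algebra_simps)
    then show ?thesis using fin by (simp flip: prod.Sigma)
  qed
  moreover have "card ?Z = (\<Sum>g\<in>UNIV. card (Z g))" using fin by (intro card_SigmaI) auto
  ultimately have "\<bar>expectation (\<lambda>\<omega>. exp (- (\<Sum>g\<in>UNIV. j g * S g \<omega>)))
      - (\<Prod>g\<in>UNIV. (1 - (1 - exp (- real (j g))) * p) ^ card (Z g))\<bar> \<le> (\<Sum>g\<in>UNIV. card (Z g)) * \<alpha>"
    by simp
  with 1 show ?thesis by linarith
qed

end

section \<open>Counting full blocks in a union of convex sets\<close>

definition full_blocks :: "int ^ 'd \<Rightarrow> (int ^ 'd) set \<Rightarrow> (int ^ 'd) set" where
  "full_blocks t B = {z. block t t z \<subseteq> B}"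

lemma base_in_block: "(\<And>l. 0 < t $ l) \<Longrightarrow> t * z \<in> block t t z"
  by (simp add: block_iff)

text \<open>A tile meeting \<open>B\<close> but not contained in it has a point in some
  \<open>K i\<close> and a point outside \<open>B\<close>, hence outside that same
  \<open>K i\<close>. It is thus a boundary block of one convex piece, and the bound for a single
  convex set is paid \<open>q\<close> times.\<close>

lemma full_blocks_count:
  fixes B :: "(int ^ 'd) set"
  assumes t: "\<And>l. 0 < t $ l" and m: "0 \<le> m"
    and B: "B = lattice_pts (\<Union>i<q. K i)" "\<And>i. i < q \<Longrightarrow> convex (K i)"
    and Bm: "\<And>v l. v \<in> B \<Longrightarrow> \<bar>v $ l div t $ l\<bar> \<le> m"
  shows finite_full_blocks: "finite (full_blocks t B)"
    and card_full_blocks_le: "card (full_blocks t B) \<le> nat (2 * m + 1) ^ CARD('d)"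
    and full_blocks_inner: "card (full_blocks t B) * (\<Prod>l\<in>UNIV. nat (t $ l)) \<le> card B"
    and full_blocks_outer: "card B \<le> (card (full_blocks t B) + q * (3 ^ CARD('d) * (2 * nat (4 * m + 1) ^ (CARD('d) - 1))))
      * (\<Prod>l\<in>UNIV. nat (t $ l))"
proof -
  let ?T = "\<Prod>l\<in>UNIV. nat (t $ l)" and ?F = "full_blocks t B"
  define I :: "(int ^ 'd) set" where "I = {(\<chi> l. - m)..(\<chi> l. m)}"
  have I_iff: "z \<in> I \<longleftrightarrow> (\<forall>l. \<bar>z $ l\<bar> \<le> m)" for z
    by (auto simp: I_def less_eq_vec_def abs_le_iff) (metis minus_le_iff)+
  have fI: "finite I" by (simp add: I_def finite_lattice_interval)
  have FI: "?F \<subseteq> I"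
  proof
    fix z assume "z \<in> ?F"
    then have "t * z \<in> B" using base_in_block[OF t] by (auto simp: full_blocks_def)
    from Bm[OF this] show "z \<in> I" using t by (simp add: I_iff less_imp_neq[symmetric])
  qed
  show fF: "finite ?F" using FI fI by (rule finite_subset)
  have "card ?F \<le> card I" using FI fI by (intro card_mono)
  also have "card I = nat (2 * m + 1) ^ CARD('d)" by (simp add: I_def card_lattice_interval)
  finally show "card ?F \<le> nat (2 * m + 1) ^ CARD('d)" .
  define bd where "bd = (\<Union>i<q. boundary_blocks t m (K i))"
  have bdI: "bd \<subseteq> I" by (auto simp: bd_def boundary_blocks_def I_iff)
  have cov: "B \<subseteq> (\<Union>z\<in>?F \<union> bd. block t t z)"
  proof
    fix v assume v: "v \<in> B"
    define z where "z = (\<chi> l. v $ l div t $ l)"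
    have vz: "v \<in> block t t z" unfolding z_def by (rule block_div[OF t])
    have zm: "\<forall>l. \<bar>z $ l\<bar> \<le> m" using Bm[OF v] by (simp add: z_def)
    show "v \<in> (\<Union>z\<in>?F \<union> bd. block t t z)"
    proof (cases "z \<in> ?F")
      case False
      then obtain y where y: "y \<in> block t t z" "y \<notin> B" by (auto simp: full_blocks_def)
      obtain i where i: "i < q" "rvec v \<in> K i" using v B(1) by (auto simp: lattice_pts_def)
      have "rvec y \<notin> K i" using y(2) i(1) B(1) by (auto simp: lattice_pts_def)
      with i y vz zm have "z \<in> bd" unfolding bd_def boundary_blocks_def by blast
      with vz show ?thesis by blast
    qed (use vz in blast)
  qed
  have fin: "finite (?F \<union> bd)" using fF finite_subset[OF bdI fI] by simp
  then have fU: "finite (\<Union>z\<in>?F \<union> bd. block t t z)" by (auto simp: finite_block)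
  have fB: "finite B" using cov fU by (rule finite_subset)
  have "card ?F * ?T = card (\<Union>z\<in>?F. block t t z)"
    using fF block_disjoint[OF t] by (subst card_UN_disjoint) (auto simp: finite_block card_block)
  also have "\<dots> \<le> card B" by (intro card_mono fB) (auto simp: full_blocks_def)
  finally show "card ?F * ?T \<le> card B" .
  have "card bd \<le> (\<Sum>i<q. card (boundary_blocks t m (K i)))" unfolding bd_def by (rule card_UN_le) simp
  also have "\<dots> \<le> (\<Sum>i<q. 3 ^ CARD('d) * (2 * nat (4 * m + 1) ^ (CARD('d) - 1)))"
    by (intro sum_mono card_boundary_blocks B(2) t m) auto
  finally have cbd: "card bd \<le> q * (3 ^ CARD('d) * (2 * nat (4 * m + 1) ^ (CARD('d) - 1)))" by simp
  have "card B \<le> card (\<Union>z\<in>?F \<union> bd. block t t z)" by (rule card_mono[OF fU cov])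
  also have "\<dots> \<le> (\<Sum>z\<in>?F \<union> bd. card (block t t z))" by (rule card_UN_le[OF fin])
  also have "\<dots> = card (?F \<union> bd) * ?T" by (simp add: card_block)
  also have "\<dots> \<le> (card ?F + card bd) * ?T" by (intro mult_right_mono card_Un_le) auto
  also have "\<dots> \<le> (card ?F + q * (3 ^ CARD('d) * (2 * nat (4 * m + 1) ^ (CARD('d) - 1)))) * ?T"
    using cbd by (intro mult_right_mono) auto
  finally show "card B \<le> \<dots>" .
qed

section \<open>Asymptotics of the block decomposition\<close>

lemma finite_lattice_pts:
  fixes A :: "(real ^ 'd) set"
  assumes "bounded A"
  shows "finite (lattice_pts A)"
proof -
  obtain b where b: "\<And>y. y \<in> A \<Longrightarrow> norm y \<le> b" using assms by (auto simp: bounded_iff)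
  have "lattice_pts A \<subseteq> {(\<chi> l. - \<lceil>b\<rceil>)..(\<chi> l. \<lceil>b\<rceil>)}"
  proof
    fix v assume "v \<in> lattice_pts A"
    then have "\<bar>rvec v $ l\<bar> \<le> b" for l
      using b component_le_norm_cart[of "rvec v" l] by (force simp: lattice_pts_def)
    then have "\<bar>real_of_int (v $ l)\<bar> \<le> b" for l by (simp add: rvec_def)
    then have "- \<lceil>b\<rceil> \<le> v $ l \<and> v $ l \<le> \<lceil>b\<rceil>" for l
      by (smt (verit, best) le_of_int_ceiling of_int_le_iff of_int_minus)
    then show "v \<in> {(\<chi> l. - \<lceil>b\<rceil>)..(\<chi> l. \<lceil>b\<rceil>)}" by (simp add: less_eq_vec_def)
  qed
  then show ?thesis by (rule finite_subset[OF _ finite_lattice_interval])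
qed

lemma bounded_scale_set:
  fixes A :: "(real ^ 'd) set"
  assumes "bounded A"
  shows "bounded (scale_set r A)"
  unfolding scale_set_def
proof (rule bounded_linear_image[OF assms])
  show "bounded_linear (\<lambda>a. r * a)"
    unfolding linear_conv_bounded_linear[symmetric]
    by (intro linearI) (simp_all add: vec_eq_iff algebra_simps)
qed

lemma mem_scale_set_iff:
  assumes "\<And>l. r $ l \<noteq> 0"
  shows "y \<in> scale_set r A \<longleftrightarrow> (\<chi> l. y $ l / r $ l) \<in> A"
proof -
  have 1: "y = r * (\<chi> l. y $ l / r $ l)" using assms by (simp add: vec_eq_iff)
  have 2: "(\<chi> l. (r * a) $ l / r $ l) = a" for a using assms by (simp add: vec_eq_iff)
  show ?thesis unfolding scale_set_def
  proof
    assume "y \<in> (\<lambda>a. r * a) ` A"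
    then obtain a where "a \<in> A" "y = r * a" by blast
    with 2[of a] show "(\<chi> l. y $ l / r $ l) \<in> A" by simp
  next
    assume "(\<chi> l. y $ l / r $ l) \<in> A"
    then show "y \<in> (\<lambda>a. r * a) ` A" using 1 by (metis (no_types, lifting) imageI)
  qed
qed

lemma mem_K_set_iff:
  assumes "\<And>l. 0 < c $ l"
  shows "v \<in> K_set \<kappa> c \<longleftrightarrow> (\<forall>l. \<bar>v $ l\<bar> \<le> \<kappa> * c $ l)"
proof -
  have "c $ l \<noteq> 0" for l using assms[of l] by simp
  then have "v \<in> K_set \<kappa> c \<longleftrightarrow> (\<forall>l. - \<kappa> \<le> v $ l / c $ l \<and> v $ l / c $ l \<le> \<kappa>)"
    by (simp add: K_set_def lattice_pts_def mem_scale_set_iff mem_box_cart rvec_def)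
  moreover have "- \<kappa> \<le> v $ l / c $ l \<and> v $ l / c $ l \<le> \<kappa> \<longleftrightarrow> \<bar>v $ l\<bar> \<le> \<kappa> * c $ l" for l
    using assms[of l] by (simp add: pos_divide_le_eq pos_le_divide_eq abs_if) linarith
  ultimately show ?thesis by simp
qed

lemma p_convex_bounded: "p_convex p C \<Longrightarrow> bounded C"
  by (auto simp: p_convex_def convex_body_def intro!: bounded_UN compact_imp_bounded)

text \<open>A cube inside one of the bodies already gives a lower bound of the right order; this
  takes the place of an asymptotic count of the lattice points in the scaled set.\<close>

lemma card_lattice_pts_scale_ge:
  fixes C :: "(real ^ 'd) set" and c :: "nat \<Rightarrow> real ^ 'd"
  assumes C: "p_convex p C" "measure lebesgue C \<noteq> 0"
    and c: "\<And>n l. 0 < c n $ l" "\<And>l. filterlim (\<lambda>n. c n $ l) at_top sequentially"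
  obtains \<delta> where "0 < \<delta>"
    "eventually (\<lambda>n. \<delta> * (\<Prod>l\<in>UNIV. c n $ l) \<le> card (lattice_pts (scale_set (c n) C))) sequentially"
proof -
  have "C \<noteq> {}" using C(2) by auto
  then obtain y e where ye: "0 < e" "cbox (\<chi> l. y $ l - e) (\<chi> l. y $ l + e) \<subseteq> C"
  proof -
    obtain K where K: "\<forall>i<p. convex_body (K i)" "C = (\<Union>i<p. K i)"
      using C(1) by (auto simp: p_convex_def)
    with \<open>C \<noteq> {}\<close> obtain i where i: "i < p" "interior (K i) \<noteq> {}" by (auto simp: convex_body_def)
    then obtain y r where r: "0 < r" "ball y r \<subseteq> K i" by (auto simp: mem_interior)
    \<comment> \<open>Half of r/d, so that points of the cube have l1-distance at most r/2 from the
      centre.\<close>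
    define e where "e = r / (2 * CARD('d))"
    have "cbox (\<chi> l. y $ l - e) (\<chi> l. y $ l + e) \<subseteq> ball y r"
    proof
      fix v assume v: "v \<in> cbox (\<chi> l. y $ l - e) (\<chi> l. y $ l + e)"
      have "norm (y - v) \<le> (\<Sum>l\<in>UNIV. \<bar>(y - v) $ l\<bar>)" by (rule norm_le_l1_cart)
      also have "\<dots> \<le> (\<Sum>l\<in>(UNIV :: 'd set). e)"
        using v by (intro sum_mono) (auto simp: mem_box_cart abs_le_iff algebra_simps)
      also have "\<dots> < r" using r by (simp add: e_def)
      finally show "v \<in> ball y r" by (simp add: dist_norm)
    qed
    then show ?thesis using that[of e y] r i K by (auto simp: e_def)
  qed
  show ?thesis
  proof (rule that[of "e ^ CARD('d)"])
    show "0 < e ^ CARD('d)" using ye by simp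
    have "eventually (\<lambda>n. \<forall>l. 1 / e \<le> c n $ l) sequentially"
      using c(2) by (intro eventually_all_finite) (auto simp: filterlim_at_top)
    then show "eventually (\<lambda>n. e ^ CARD('d) * (\<Prod>l\<in>UNIV. c n $ l) \<le> card (lattice_pts (scale_set (c n) C))) sequentially"
    proof eventually_elim
      case (elim n)
      define a b :: "int ^ 'd" where "a = (\<chi> l. \<lceil>c n $ l * (y $ l - e)\<rceil>)"
        and "b = (\<chi> l. \<lfloor>c n $ l * (y $ l + e)\<rfloor>)"
      have "{a..b} \<subseteq> lattice_pts (scale_set (c n) C)"
      proof
        fix v assume v: "v \<in> {a..b}"
        have "c n $ l * (y $ l - e) \<le> v $ l \<and> v $ l \<le> c n $ l * (y $ l + e)" for l
          using v by (auto simp: a_def b_def less_eq_vec_def ceiling_le_iff le_floor_iff)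
        then have "y $ l - e \<le> v $ l / c n $ l \<and> v $ l / c n $ l \<le> y $ l + e" for l
          using c(1)[of n l] by (simp add: pos_le_divide_eq pos_divide_le_eq mult.commute)
        then have "(\<chi> l. rvec v $ l / c n $ l) \<in> C"
          by (intro subsetD[OF ye(2)]) (simp add: mem_box_cart rvec_def)
        then show "v \<in> lattice_pts (scale_set (c n) C)"
          using c(1) by (simp add: lattice_pts_def mem_scale_set_iff less_imp_neq[symmetric])
      qed
      then have "card {a..b} \<le> card (lattice_pts (scale_set (c n) C))"
        by (intro card_mono finite_lattice_pts bounded_scale_set p_convex_bounded[OF C(1)])
      moreover have "e ^ CARD('d) * (\<Prod>l\<in>UNIV. c n $ l) \<le> card {a..b}"
      proof -
        \<comment> \<open>An interval of length 2ec contains more than 2ec - 1 integers, which is at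
          least ec once ec is at least 1.\<close>
        have "e * c n $ l \<le> real (nat (b $ l - a $ l + 1))" for l
        proof -
          have "1 \<le> e * c n $ l" using elim ye(1) by (simp add: pos_divide_le_eq mult.commute)
          moreover have "c n $ l * (y $ l + e) - 1 < b $ l" "a $ l < c n $ l * (y $ l - e) + 1"
            unfolding a_def b_def by simp_all linarith+
          ultimately have "e * c n $ l \<le> real_of_int (b $ l - a $ l + 1)" by (simp add: algebra_simps)
          then show ?thesis by linarith
        qed
        then have "(\<Prod>l\<in>UNIV. e * c n $ l) \<le> (\<Prod>l\<in>UNIV. real (nat (b $ l - a $ l + 1)))"
          using ye(1) c(1)[of n] by (intro prod_mono) (auto intro: less_imp_le)
        then show ?thesis by (simp add: prod.distrib card_lattice_interval)
      qed
      ultimately show ?case by linarith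
    qed
  qed
qed

locale block_scheme =
  fixes c :: "nat \<Rightarrow> real ^ 'd" and k :: "nat \<Rightarrow> nat" and \<gamma> :: "nat \<Rightarrow> real ^ 'd"
  assumes c_pos: "\<And>n l. 0 < c n $ l"
    and k_pos: "\<And>n. 0 < k n"
    and k_lim: "filterlim k at_top sequentially"
    and k_small: "\<And>l. (\<lambda>n. root CARD('d) (real (k n)) / c n $ l) \<longlonglongrightarrow> 0"
    and k_gamma: "vec_smallo (\<lambda>n. root CARD('d) (real (k n)) *\<^sub>R \<gamma> n) c"
begin

definition r :: "nat \<Rightarrow> real" where
  "r n = root CARD('d) (real (k n))"

definition t :: "nat \<Rightarrow> int ^ 'd" where
  "t n = box_len (c n) (k n)"

text \<open>Rounding up keeps the sides integral and the margin at least
  \<open>\<bar>\<gamma> n $ l\<bar>\<close>. Early sides may be negative, which leaves empty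
  blocks.\<close>

definition s :: "nat \<Rightarrow> int ^ 'd" where
  "s n = (\<chi> l. t n $ l - \<lceil>\<bar>\<gamma> n $ l\<bar>\<rceil>)"

definition vol :: "nat \<Rightarrow> nat" where
  "vol n = (\<Prod>l\<in>UNIV. nat (t n $ l))"

text \<open>Bound on block indices: a point of \<open>K_set \<kappa> (c n)\<close> divided by
  \<open>t n $ l\<close> is at most 2\<kappa> c / (2t), twice over because of the floor in
  \<open>t\<close>, hence at most 2\<kappa> r in modulus; the 1 absorbs the integer
  division.\<close>

definition m :: "real \<Rightarrow> nat \<Rightarrow> int" where
  "m \<kappa> n = \<lceil>2 * \<kappa> * r n\<rceil> + 1"

lemma r_ge_1: "1 \<le> r n"
  using k_pos[of n] by (simp add: r_def)

lemma r_power: "r n ^ CARD('d) = k n"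
  by (simp add: r_def)

lemma r_lim: "filterlim r at_top sequentially"
proof -
  have k: "filterlim (\<lambda>n. real (k n)) at_top sequentially"
    by (rule filterlim_compose[OF filterlim_real_sequentially k_lim])
  have "eventually (\<lambda>n. b \<le> r n) sequentially" for b
  proof -
    have "eventually (\<lambda>n. max 0 b ^ CARD('d) \<le> real (k n)) sequentially"
      using k by (simp add: filterlim_at_top)
    then show ?thesis
    proof eventually_elim
      case (elim n)
      then have "max 0 b ^ CARD('d) \<le> r n ^ CARD('d)" by (simp add: r_power)
      then have "max 0 b \<le> r n" using r_ge_1[of n] by (subst (asm) power_mono_iff) auto
      then show ?case by simp
    qed
  qed
  then show ?thesis by (simp add: filterlim_at_top)
qed

lemma t_le: "real_of_int (t n $ l) \<le> c n $ l / r n"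
  by (simp add: t_def box_len_def r_def)

lemma t_nonneg: "0 \<le> t n $ l"
  using c_pos[of n l] r_ge_1[of n] by (simp add: t_def box_len_def r_def)

text \<open>Once c / r is at least 1, taking the floor loses at most a factor 2.\<close>

lemma eventually_t: "eventually (\<lambda>n. \<forall>l. 0 < t n $ l \<and> c n $ l \<le> 2 * r n * t n $ l) sequentially"
proof (intro eventually_all_finite)
  fix l
  have "eventually (\<lambda>n. r n / c n $ l < 1) sequentially"
    unfolding r_def by (rule order_tendstoD(2)[OF k_small]) simp
  then show "eventually (\<lambda>n. 0 < t n $ l \<and> c n $ l \<le> 2 * r n * t n $ l) sequentially"
  proof eventually_elim
    case (elim n)
    then have q: "1 \<le> c n $ l / r n" using c_pos[of n l] r_ge_1[of n] by (simp add: divide_simps)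
    have tl: "t n $ l = \<lfloor>c n $ l / r n\<rfloor>" by (simp add: t_def box_len_def r_def)
    then have "0 < t n $ l" using q by (simp add: le_floor_iff flip: int_one_le_iff_zero_less)
    moreover have "c n $ l / r n < t n $ l + 1" unfolding tl by linarith
    ultimately have "c n $ l / r n \<le> 2 * t n $ l" by linarith
    with \<open>0 < t n $ l\<close> show ?case using r_ge_1[of n] by (simp add: divide_simps mult_ac)
  qed
qed

lemma vol_le: "real (vol n) * k n \<le> (\<Prod>l\<in>UNIV. c n $ l)"
proof -
  have "real (vol n) * k n = (\<Prod>l\<in>UNIV. t n $ l * r n)"
    by (simp add: vol_def prod.distrib r_power t_nonneg)
  also have "\<dots> \<le> (\<Prod>l\<in>UNIV. c n $ l)"
    using r_ge_1[of n] t_le[of n] t_nonneg[of n] by (intro prod_mono) (simp add: pos_le_divide_eq)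
  finally show ?thesis .
qed

lemma s_le: "s n $ l \<le> t n $ l"
  by (simp add: s_def)

lemma gamma_le: "\<bar>\<gamma> n $ l\<bar> \<le> real_of_int (t n $ l - s n $ l)"
  by (simp add: s_def)

text \<open>The removed fraction in one coordinate is at most
  \<open>(\<bar>\<gamma> n $ l\<bar> + 1) / t n $ l\<close>, hence at most 2r(\<bar>\<gamma>\<bar> +
  1)/c. The \<gamma>-part vanishes by \<open>k_gamma\<close>, the rounding part by
  \<open>k_small\<close>.\<close>

lemma shrink: "(\<lambda>n. card (block (t n) (s n) 0) / vol n) \<longlonglongrightarrow> 1"
proof -
  have one: "(\<lambda>n. real (nat (s n $ l)) / real (nat (t n $ l))) \<longlonglongrightarrow> 1" for l
  proof -
    let ?h = "\<lambda>n. 2 * \<bar>r n * \<gamma> n $ l / c n $ l\<bar> + 2 * (r n / c n $ l)"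
    have h: "?h \<longlonglongrightarrow> 0"
    proof -
      have "(\<lambda>n. r n * \<gamma> n $ l / c n $ l) \<longlonglongrightarrow> 0" using k_gamma by (simp add: vec_smallo_def r_def)
      then have "?h \<longlonglongrightarrow> 2 * \<bar>0\<bar> + 2 * 0"
        using k_small[of l] unfolding r_def by (intro tendsto_intros)
      then show ?thesis by simp
    qed
    have "eventually (\<lambda>n. ?h n < 1) sequentially" using h by (rule order_tendstoD) simp
    with eventually_t have "eventually (\<lambda>n. norm (real (nat (s n $ l)) / real (nat (t n $ l)) - 1) \<le> ?h n) sequentially"
    proof eventually_elim
      case (elim n)
      let ?T = "real_of_int (t n $ l)" and ?G = "real_of_int \<lceil>\<bar>\<gamma> n $ l\<bar>\<rceil>"
      have T: "0 < ?T" "c n $ l \<le> 2 * r n * ?T" using elim by auto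
      have "1 / ?T \<le> 2 * r n / c n $ l" using T c_pos[of n l] by (simp add: divide_simps mult_ac)
      then have "(\<bar>\<gamma> n $ l\<bar> + 1) * (1 / ?T) \<le> (\<bar>\<gamma> n $ l\<bar> + 1) * (2 * r n / c n $ l)"
        by (intro mult_left_mono) auto
      also have "\<dots> = ?h n" using c_pos[of n l] r_ge_1[of n] by (simp add: abs_mult field_simps)
      finally have "(\<bar>\<gamma> n $ l\<bar> + 1) / ?T \<le> ?h n" by simp
      moreover have "?G / ?T \<le> (\<bar>\<gamma> n $ l\<bar> + 1) / ?T" using T by (intro divide_right_mono) linarith+
      ultimately have G: "?G / ?T \<le> ?h n" by linarith
      with elim have "?G / ?T < 1" by linarith
      then have "?G < ?T" using T by (simp add: divide_less_eq)
      then have "0 \<le> s n $ l" by (simp add: s_def)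
      then have "real (nat (s n $ l)) / real (nat (t n $ l)) = (?T - ?G) / ?T"
        using T by (simp add: s_def)
      also have "\<dots> = 1 - ?G / ?T" using T by (simp add: diff_divide_distrib)
      finally have "norm (real (nat (s n $ l)) / real (nat (t n $ l)) - 1) = ?G / ?T"
        using T by simp
      with G show ?case by simp
    qed
    from Lim_null_comparison[OF this h] show ?thesis by (simp add: LIM_zero_iff)
  qed
  have "(\<lambda>n. \<Prod>l\<in>UNIV. real (nat (s n $ l)) / real (nat (t n $ l))) \<longlonglongrightarrow> (\<Prod>l\<in>(UNIV :: 'd set). 1)"
    by (intro tendsto_prod one)
  then show ?thesis by (simp add: card_block vol_def prod_dividef)
qed

lemma m_nonneg:
  assumes "0 < \<kappa>"
  shows "0 \<le> m \<kappa> n"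
proof -
  have "0 \<le> 2 * \<kappa> * r n" using assms r_ge_1[of n] by simp
  then show ?thesis unfolding m_def by linarith
qed

text \<open>From 4(2\<kappa>r + 2) + 1 = 8\<kappa>r + 9 and \<open>1 \<le> r n\<close>.\<close>

lemma m_bound:
  assumes "0 < \<kappa>"
  shows "real (nat (4 * m \<kappa> n + 1)) \<le> (8 * \<kappa> + 9) * r n"
proof -
  have "real (nat (4 * m \<kappa> n + 1)) = 4 * real_of_int (m \<kappa> n) + 1" using m_nonneg[OF assms, of n] by simp
  also have "\<dots> \<le> 8 * \<kappa> * r n + 9" unfolding m_def by (simp, linarith)
  also have "\<dots> \<le> (8 * \<kappa> + 9) * r n" using r_ge_1[of n] by (simp add: algebra_simps)
  finally show ?thesis .
qed

lemma eventually_div_le: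
  assumes "0 < \<kappa>"
  shows "eventually (\<lambda>n. \<forall>v\<in>K_set \<kappa> (c n). \<forall>l. \<bar>v $ l div t n $ l\<bar> \<le> m \<kappa> n) sequentially"
  using eventually_t
proof eventually_elim
  case (elim n)
  show ?case
  proof (intro ballI allI)
    fix v l assume "v \<in> K_set \<kappa> (c n)"
    then have "\<bar>real_of_int (v $ l)\<bar> \<le> \<kappa> * c n $ l" using c_pos by (simp add: mem_K_set_iff)
    also have "\<dots> \<le> \<kappa> * (2 * r n * t n $ l)" using elim assms by (intro mult_left_mono) auto
    finally have "\<bar>real_of_int (v $ l)\<bar> / t n $ l \<le> 2 * \<kappa> * r n"
      using elim by (simp add: pos_divide_le_eq mult_ac)
    then have b: "\<bar>real_of_int (v $ l) / t n $ l\<bar> \<le> 2 * \<kappa> * r n"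
      using elim[rule_format, of l] by (simp add: abs_divide)
    have "v $ l div t n $ l = \<lfloor>real_of_int (v $ l) / t n $ l\<rfloor>" by (simp add: floor_divide_of_int_eq)
    with b show "\<bar>v $ l div t n $ l\<bar> \<le> m \<kappa> n" unfolding m_def by linarith
  qed
qed

text \<open>Connects \<open>D n\<close> with \<open>K_set\<close>, which is only known to contain
  \<open>D_plus\<close>. The inclusion starts once all sides \<open>t n $ l\<close> are positive,
  when every point lies in some half-open box.\<close>

lemma eventually_subset_D_plus:
  "eventually (\<lambda>n. lattice_pts (scale_set (c n) C) \<subseteq> D_plus C (c n) (k n)) sequentially"
  using eventually_t
proof eventually_elim
  case (elim n)
  show ?case
  proof
    fix v assume v: "v \<in> lattice_pts (scale_set (c n) C)"
    define z where "z = (\<chi> l. v $ l div t n $ l)"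
    define y where "y = (\<chi> l. frac (real_of_int (v $ l) / t n $ l))"
    have "rvec v = rvec (t n) * (rvec z + y)"
    proof -
      have "real_of_int (v $ l) = t n $ l * (real_of_int \<lfloor>real_of_int (v $ l) / t n $ l\<rfloor> + frac (real_of_int (v $ l) / t n $ l))" for l
        using elim[rule_format, of l] by (simp add: frac_def)
      then show ?thesis by (simp add: vec_eq_iff rvec_def z_def y_def floor_divide_of_int_eq)
    qed
    moreover have "\<forall>l. 0 \<le> y $ l \<and> y $ l < 1" by (simp add: y_def frac_lt_1)
    ultimately have "rvec v \<in> I_box (c n) (k n) z"
      unfolding I_box_def scale_set_def t_def[symmetric] by blast
    then show "v \<in> D_plus C (c n) (k n)"
      using v unfolding D_plus_def J_box_def lattice_pts_def by blast
  qed
qed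

text \<open>There are O(r^(d-1)) boundary blocks, and a block has at most r^(-d) times the product
  of the \<open>c n $ l\<close> points. The lattice points missed are therefore O(d n / r n), and
  the count of full blocks is squeezed between \<open>card (B n) / d n\<close> and the same minus
  \<open>A / r n\<close>.\<close>

lemma full_blocks_tendsto:
  fixes \<kappa> \<delta> b :: real and d :: "nat \<Rightarrow> real"
  assumes kap: "0 < \<kappa>" and del: "0 < \<delta>" and d: "eventually (\<lambda>n. \<delta> * (\<Prod>l\<in>UNIV. c n $ l) \<le> d n) sequentially"
    and B: "\<And>n. p_convex q (Bbar n)" "\<And>n. B n = lattice_pts (Bbar n)"
    and BK: "eventually (\<lambda>n. B n \<subseteq> K_set \<kappa> (c n)) sequentially"
    and lim: "(\<lambda>n. card (B n) / d n) \<longlonglongrightarrow> b"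
  shows "(\<lambda>n. card (full_blocks (t n) (B n)) * vol n / d n) \<longlonglongrightarrow> b"
    and "eventually (\<lambda>n. finite (full_blocks (t n) (B n)) \<and>
           card (full_blocks (t n) (B n)) \<le> (8 * \<kappa> + 9) ^ CARD('d) * k n) sequentially"
proof -
  \<comment> \<open>Number of pieces times the boundary constant, with \<open>m_bound\<close>
    inserted; \<delta> converts the product of the \<open>c n $ l\<close> into
    \<open>d n\<close>.\<close>
  define A where "A = q * 3 ^ CARD('d) * 2 * (8 * \<kappa> + 9) ^ (CARD('d) - 1) / \<delta>"
  have main: "eventually (\<lambda>n. finite (full_blocks (t n) (B n)) \<and>
      card (full_blocks (t n) (B n)) \<le> (8 * \<kappa> + 9) ^ CARD('d) * k n \<and>
      card (full_blocks (t n) (B n)) * vol n / d n \<le> card (B n) / d n \<and>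
      card (B n) / d n - A / r n \<le> card (full_blocks (t n) (B n)) * vol n / d n) sequentially"
    using eventually_t d BK eventually_div_le[OF kap]
  proof eventually_elim
    case (elim n)
    let ?F = "full_blocks (t n) (B n)" and ?P = "\<Prod>l\<in>UNIV. c n $ l"
    let ?e = "real (nat (4 * m \<kappa> n + 1))"
    obtain K where K: "\<forall>i<q. convex_body (K i)" "Bbar n = (\<Union>i<q. K i)"
      using B(1)[of n] by (auto simp: p_convex_def)
    have t: "0 < t n $ l" for l using elim by auto
    have Beq: "B n = lattice_pts (\<Union>i<q. K i)" using B(2) K by simp
    have conv: "convex (K i)" if "i < q" for i using K that by (simp add: convex_body_def)
    have dm: "\<bar>v $ l div t n $ l\<bar> \<le> m \<kappa> n" if "v \<in> B n" for v l using elim that by blast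
    note fb = full_blocks_count[OF t m_nonneg[OF kap] Beq conv dm, folded vol_def]
    have P: "0 < ?P" using c_pos by (simp add: prod_pos)
    have dn: "0 < d n" using mult_pos_pos[OF del P] elim by linarith
    have "real (card ?F) \<le> real (nat (2 * m \<kappa> n + 1)) ^ CARD('d)"
      using fb(2) by (simp flip: of_nat_power)
    also have "\<dots> \<le> ?e ^ CARD('d)" using m_nonneg[OF kap, of n] by (intro power_mono) auto
    also have "\<dots> \<le> ((8 * \<kappa> + 9) * r n) ^ CARD('d)" using m_bound[OF kap] by (intro power_mono) auto
    also have "\<dots> = (8 * \<kappa> + 9) ^ CARD('d) * k n" by (simp add: power_mult_distrib r_power)
    finally have 1: "real (card ?F) \<le> \<dots>" .
    have "real (card ?F) * vol n \<le> card (B n)" using fb(3) by (simp flip: of_nat_mult)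
    then have 2: "card ?F * vol n / d n \<le> card (B n) / d n" using dn by (intro divide_right_mono) auto
    have "real (card (B n)) \<le> real ((card ?F + q * (3 ^ CARD('d) * (2 * nat (4 * m \<kappa> n + 1) ^ (CARD('d) - 1)))) * vol n)"
      using fb(4) by (simp only: of_nat_le_iff)
    also have "\<dots> = card ?F * vol n + q * 3 ^ CARD('d) * 2 * (?e ^ (CARD('d) - 1) * vol n)"
      by (simp add: algebra_simps)
    finally have 3: "card (B n) - real (card ?F) * vol n \<le> q * 3 ^ CARD('d) * 2 * (?e ^ (CARD('d) - 1) * vol n)"
      by simp
    have "?e ^ (CARD('d) - 1) * vol n \<le> (8 * \<kappa> + 9) ^ (CARD('d) - 1) / \<delta> * d n / r n"
    proof -
      \<comment> \<open>Splitting off one factor \<open>r n\<close> is the whole gain: boundary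
        blocks number r^(d-1) up to a constant, while r^d blocks fill the volume.\<close>
      have kr: "real (k n) = r n ^ (CARD('d) - 1) * r n"
        using power_minus_mult[of "CARD('d)" "r n"] by (simp add: r_power)
      have "r n ^ (CARD('d) - 1) * real (vol n) * r n = real (vol n) * real (k n)"
        by (simp add: kr)
      also have "\<dots> \<le> ?P" by (rule vol_le)
      also have "\<dots> \<le> d n / \<delta>" using elim del by (simp add: pos_le_divide_eq mult.commute)
      finally have v: "r n ^ (CARD('d) - 1) * vol n \<le> d n / \<delta> / r n"
        using r_ge_1[of n] by (subst pos_le_divide_eq) auto
      have "?e ^ (CARD('d) - 1) * vol n \<le> ((8 * \<kappa> + 9) * r n) ^ (CARD('d) - 1) * vol n"
        using m_bound[OF kap] by (intro mult_right_mono power_mono) auto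
      also have "\<dots> = (8 * \<kappa> + 9) ^ (CARD('d) - 1) * (r n ^ (CARD('d) - 1) * vol n)"
        by (simp add: power_mult_distrib)
      also have "\<dots> \<le> (8 * \<kappa> + 9) ^ (CARD('d) - 1) * (d n / \<delta> / r n)"
        using kap v by (intro mult_left_mono) auto
      finally show ?thesis by simp
    qed
    then have "q * 3 ^ CARD('d) * 2 * (?e ^ (CARD('d) - 1) * vol n)
        \<le> q * 3 ^ CARD('d) * 2 * ((8 * \<kappa> + 9) ^ (CARD('d) - 1) / \<delta> * d n / r n)"
      by (intro mult_left_mono) auto
    with 3 have "card (B n) - real (card ?F) * vol n \<le> A / r n * d n" by (simp add: A_def mult_ac)
    then have "(card (B n) - real (card ?F) * vol n) / d n \<le> A / r n"
      using dn by (simp add: pos_divide_le_eq)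
    then have "card (B n) / d n - A / r n \<le> card ?F * vol n / d n" by (simp add: diff_divide_distrib)
    with 1 2 fb(1) show ?case by simp
  qed
  show "eventually (\<lambda>n. finite (full_blocks (t n) (B n)) \<and>
      card (full_blocks (t n) (B n)) \<le> (8 * \<kappa> + 9) ^ CARD('d) * k n) sequentially"
    using main by eventually_elim simp
  have "(\<lambda>n. A / r n) \<longlonglongrightarrow> 0"
    by (intro tendsto_divide_0[OF tendsto_const] filterlim_at_top_imp_at_infinity r_lim)
  from tendsto_diff[OF lim this] have low: "(\<lambda>n. card (B n) / d n - A / r n) \<longlonglongrightarrow> b" by simp
  show "(\<lambda>n. card (full_blocks (t n) (B n)) * vol n / d n) \<longlonglongrightarrow> b"
    by (rule tendsto_sandwich[OF _ _ low lim]) (use main in \<open>eventually_elim, simp\<close>)+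
qed

end

section \<open>Poisson convergence\<close>

lemma laplace_indep_poisson:
  fixes L :: "'g::finite \<Rightarrow> 'c \<Rightarrow> nat" and j :: "'g \<Rightarrow> nat"
  assumes "prob_space N" and indep: "prob_space.indep_vars N (\<lambda>_. count_space UNIV) L UNIV"
    and law: "\<And>g. distr N (count_space UNIV) (L g) = measure_pmf (poisson_law (r g))"
    and r: "\<And>g. 0 \<le> r g"
  shows "(\<integral>\<omega>. exp (- (\<Sum>g\<in>UNIV. j g * real (L g \<omega>))) \<partial>N) = (\<Prod>g\<in>UNIV. exp (- ((1 - exp (- real (j g))) * r g)))"
proof -
  interpret N: prob_space N by fact
  have L: "L g \<in> N \<rightarrow>\<^sub>M count_space UNIV" for g using indep by (simp add: N.indep_vars_def)
  have "(\<integral>\<omega>. exp (- (\<Sum>g\<in>UNIV. j g * real (L g \<omega>))) \<partial>N) = (\<integral>\<omega>. (\<Prod>g\<in>UNIV. exp (- real (j g)) ^ L g \<omega>) \<partial>N)"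
    by (simp add: mult.commute flip: exp_of_nat_mult exp_sum sum_negf)
  also have "\<dots> = (\<Prod>g\<in>UNIV. \<integral>\<omega>. exp (- real (j g)) ^ L g \<omega> \<partial>N)"
  proof (rule N.indep_vars_lebesgue_integral)
    show "N.indep_vars (\<lambda>_. borel) (\<lambda>g \<omega>. exp (- real (j g)) ^ L g \<omega>) UNIV"
      by (rule N.indep_vars_compose2[OF indep]) simp
    show "integrable N (\<lambda>\<omega>. exp (- real (j g)) ^ L g \<omega>)" for g
      by (intro N.integrable_const_bound[of _ 1] AE_I2 measurable_compose[OF L]) (auto intro!: power_le_one)
  qed auto
  also have "\<dots> = (\<Prod>g\<in>UNIV. exp (- ((1 - exp (- real (j g))) * r g)))"
  proof (rule prod.cong[OF refl])
    fix g
    have "(\<integral>\<omega>. exp (- real (j g)) ^ L g \<omega> \<partial>N) = (\<integral>i. exp (- real (j g)) ^ i \<partial>distr N (count_space UNIV) (L g))"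
      by (rule integral_distr[symmetric, OF L]) simp
    also have "\<dots> = exp (- ((1 - exp (- real (j g))) * r g))"
      unfolding law by (intro integral_poisson_law r) auto
    finally show "(\<integral>\<omega>. exp (- real (j g)) ^ L g \<omega> \<partial>N) = exp (- ((1 - exp (- real (j g))) * r g))" .
  qed
  finally show ?thesis .
qed

lemma exceedances_eq_count:
  assumes "stationary_prob_field M \<xi>" "finite A" "A \<subseteq> D"
  shows "exceedances \<xi> D x A \<omega> = stationary_prob_field.count \<xi> x A \<omega>"
proof -
  interpret stationary_prob_field M \<xi> by fact
  have "exceedances \<xi> D x A \<omega> = (\<Sum>\<^sub>\<infinity>z\<in>A. indicat_real {x<..} (\<xi> z \<omega>))"
    unfolding exceedances_def using assms(3)
    by (intro infsum_cong_neutral) (auto simp: indicator_def)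
  then show ?thesis using assms(2) by (simp add: count_def)
qed

text \<open>Translation by \<open>- v\<close> turns a comparison inside one block into a comparison
  with the origin, where the local condition is stated.\<close>

lemma A_set_diff:
  fixes v w :: "int ^ 'd"
  assumes R: "translation_invariant_order R" and "(v, w) \<in> R" "v \<noteq> w"
    and t: "\<And>l. 0 < box_len c k $ l" "\<And>l. \<bar>w $ l - v $ l\<bar> \<le> box_len c k $ l"
  shows "w - v \<in> A_set R c k 0"
proof -
  define y :: "real ^ 'd" where "y = (\<chi> l. real_of_int (w $ l - v $ l) / box_len c k $ l)"
  have "\<bar>y $ l\<bar> \<le> 1" for l
  proof -
    have "real_of_int \<bar>w $ l - v $ l\<bar> \<le> box_len c k $ l" using t(2) by (simp only: of_int_le_iff)
    then show ?thesis using t(1)[of l] by (simp add: y_def abs_divide)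
  qed
  then have "y \<in> cbox (vec (- 1)) (vec 1)" by (simp add: mem_box_cart abs_le_iff minus_le_iff)
  moreover have "box_len c k $ l \<noteq> 0" for l using t(1)[of l] by simp
  then have "rvec (w - v) = rvec 0 + rvec (box_len c k) * y" by (simp add: vec_eq_iff rvec_def y_def)
  moreover have "(v + - v, w + - v) \<in> R" using R \<open>(v, w) \<in> R\<close> unfolding translation_invariant_order_def by blast
  ultimately show ?thesis
    using \<open>v \<noteq> w\<close> unfolding A_set_def lattice_pts_def scale_set_def by auto
qed

lemma finite_A_set: "finite (A_set R c k v)"
proof -
  have "bounded ((\<lambda>y. rvec v + y) ` scale_set (rvec (box_len c k)) (cbox (vec (- 1)) (vec 1)))"
    by (intro bounded_translation bounded_scale_set bounded_cbox)
  from finite_lattice_pts[OF this] show ?thesis unfolding A_set_def by (rule finite_subset[rotated]) auto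
qed

theorem theorem7p3:
  fixes C :: "(real ^ 'd) set" and p :: nat
    and c :: "nat \<Rightarrow> real ^ 'd"
    and D :: "nat \<Rightarrow> (int ^ 'd) set"
    and \<kappa> :: real
    and M :: "'a measure" and \<xi> :: "int ^ 'd \<Rightarrow> 'a \<Rightarrow> real"
    and x :: "nat \<Rightarrow> real"
    and \<gamma> :: "nat \<Rightarrow> real ^ 'd" and \<alpha> :: "nat \<Rightarrow> real"
    and k :: "nat \<Rightarrow> nat"
    and R :: "((int ^ 'd) \<times> (int ^ 'd)) set"
    and B :: "'g::finite \<Rightarrow> nat \<Rightarrow> (int ^ 'd) set"
    and b :: "'g \<Rightarrow> real" and \<tau> :: real
    and N :: "'c measure" and L :: "'g \<Rightarrow> 'c \<Rightarrow> nat"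
  assumes C: "p_convex p C" "measure lebesgue C = 1"
    and c_pos: "\<And>n l. 0 < c n $ l"
    and c_lim: "\<And>l. filterlim (\<lambda>n. c n $ l) at_top sequentially"
    and D_eq: "\<And>n. D n = lattice_pts (scale_set (c n) C)"
    and prob: "prob_space M"
    and meas: "\<And>v. \<xi> v \<in> borel_measurable M"
    and stat: "stationary_field M \<xi>"
    and kappa: "0 < \<kappa>" "\<And>n. D_plus C (c n) (k n) \<subseteq> K_set \<kappa> (c n)"
    and cond_D: "cond_D M \<xi> c x (\<lambda>n. K_set \<kappa> (c n)) \<gamma> \<alpha>"
    and k_pos: "\<And>n. 0 < k n"
    and k_lim: "filterlim k at_top sequentially"
    and k_small: "\<And>l. (\<lambda>n. root CARD('d) (real (k n)) / c n $ l) \<longlonglongrightarrow> 0"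
    and k_alpha: "(\<lambda>n. real (k n) * \<alpha> n) \<longlonglongrightarrow> 0"
    and k_gamma: "vec_smallo (\<lambda>n. root CARD('d) (real (k n)) *\<^sub>R \<gamma> n) c"
    and order: "translation_invariant_order R"
    and cond_Dl: "cond_Dl M \<xi> R c x k"
    and B_geom: "\<And>g. geometric_assumption (B g)"
    and B_sub: "\<And>g n. B g n \<subseteq> D n"
    and B_disj: "\<And>n. disjoint_family (\<lambda>g. B g n)"
    and b_nonneg: "\<And>g. 0 \<le> b g"
    and b_lim: "\<And>g. (\<lambda>n. real (card (B g n)) / real (card (D n))) \<longlonglongrightarrow> b g"
    and tau_pos: "0 < \<tau>"
    and tau_lim: "(\<lambda>n. real (card (D n)) * \<P>(\<omega> in M. x n < \<xi> 0 \<omega>)) \<longlonglongrightarrow> \<tau>"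
    and prob_N: "prob_space N"
    and L_indep: "prob_space.indep_vars N (\<lambda>_. count_space UNIV) L UNIV"
    and L_poisson: "\<And>g. distr N (count_space UNIV) (L g) = measure_pmf (poisson_law (b g * \<tau>))"
  shows "converges_in_distribution M
           (\<lambda>n \<omega>. (\<chi> g. exceedances \<xi> (D n) (x n) (B g n) \<omega>) :: real ^ 'g)
           N (\<lambda>\<omega>. \<chi> g. real (L g \<omega>))"
proof -
  have field: "stationary_prob_field M \<xi>"
    using prob meas stat by (simp add: stationary_prob_field_def stationary_prob_field_axioms_def)
  interpret P: stationary_prob_field M \<xi> by (rule field)
  interpret S: block_scheme c k \<gamma>
    using c_pos k_pos k_lim k_small k_gamma by unfold_locales
  interpret N: prob_space N by (rule prob_N)
  define d where "d n = real (card (D n))" for n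
  define P0 where "P0 n = P.exc (x n)" for n
  define F where "F g n = full_blocks (S.t n) (B g n)" for g n
  define J where "J n = block (S.t n) (S.s n) 0" for n
  \<comment> \<open>By stationarity this is the probability of an exceedance in any one of the
    shrunk blocks.\<close>
  define pn where "pn n = 1 - P.void (x n) (J n)" for n
  define A0 where "A0 n = A_set R (c n) (k n) 0" for n
  \<comment> \<open>Numerator of the conditional probability in \<open>cond_Dl\<close>.\<close>
  define Q where "Q n = P.prob {\<omega> \<in> space M. (\<forall>z\<in>A0 n. \<xi> z \<omega> \<le> x n) \<and> x n < \<xi> 0 \<omega>}" for n

  have fin_D: "finite (D n)" for n
    unfolding D_eq by (intro finite_lattice_pts bounded_scale_set p_convex_bounded[OF C(1)])
  have fin_B: "finite (B g n)" for g n by (rule finite_subset[OF B_sub fin_D])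
  have DK: "eventually (\<lambda>n. D n \<subseteq> K_set \<kappa> (c n)) sequentially"
    using S.eventually_subset_D_plus[of C] by eventually_elim (use kappa(2) D_eq in blast)
  then have BK: "eventually (\<lambda>n. B g n \<subseteq> K_set \<kappa> (c n)) sequentially" for g
    by eventually_elim (use B_sub in blast)
  obtain \<delta> where \<delta>: "0 < \<delta>" "eventually (\<lambda>n. \<delta> * (\<Prod>l\<in>UNIV. c n $ l) \<le> d n) sequentially"
    using card_lattice_pts_scale_ge[OF C(1) _ c_pos c_lim] C(2) unfolding d_def D_eq by auto
  have d_pos: "eventually (\<lambda>n. 0 < d n) sequentially"
    using \<delta>(2)
  proof eventually_elim
    case (elim n)
    have "0 < (\<Prod>l\<in>UNIV. c n $ l)" using c_pos by (simp add: prod_pos)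
    from mult_pos_pos[OF \<delta>(1) this] elim show ?case by linarith
  qed
  have dP0: "(\<lambda>n. d n * P0 n) \<longlonglongrightarrow> \<tau>" using tau_lim by (simp add: d_def P0_def P.exc_def)
  have P0_pos: "eventually (\<lambda>n. 0 < P0 n) sequentially"
    using order_tendstoD(1)[OF dP0 tau_pos] d_pos
    by eventually_elim (simp add: zero_less_mult_iff)
  have F_lim: "(\<lambda>n. card (F g n) * S.vol n / d n) \<longlonglongrightarrow> b g"
    and F_le: "eventually (\<lambda>n. finite (F g n) \<and> card (F g n) \<le> (8 * \<kappa> + 9) ^ CARD('d) * k n) sequentially" for g
  proof -
    \<comment> \<open>The number \<open>q\<close> of bodies does not vary with \<open>n\<close>, so
      the boundary constant is the same for all \<open>n\<close>.\<close>
    obtain q Bbar where q: "\<And>n. p_convex q (Bbar n)" "\<And>n. B g n = lattice_pts (Bbar n)"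
      using B_geom[of g] unfolding geometric_assumption_def by blast
    have "(\<lambda>n. card (B g n) / d n) \<longlonglongrightarrow> b g" using b_lim by (simp add: d_def)
    note S.full_blocks_tendsto[OF kappa(1) \<delta> q BK this]
    then show "(\<lambda>n. card (F g n) * S.vol n / d n) \<longlonglongrightarrow> b g"
      and "eventually (\<lambda>n. finite (F g n) \<and> card (F g n) \<le> (8 * \<kappa> + 9) ^ CARD('d) * k n) sequentially"
      by (simp_all add: F_def)
  qed
  have F_le_all: "eventually (\<lambda>n. \<forall>g. finite (F g n) \<and> card (F g n) \<le> (8 * \<kappa> + 9) ^ CARD('d) * k n) sequentially"
    by (intro eventually_all_finite F_le)
  have vol_pos: "eventually (\<lambda>n. 0 < S.vol n) sequentially"
    using S.eventually_t by eventually_elim (simp add: S.vol_def)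

  have fin_J: "finite (J n)" for n by (simp add: J_def finite_block)
  have pn_nonneg: "0 \<le> pn n" for n using P.void_bounds by (simp add: pn_def)
  have pn_le: "pn n \<le> card (J n) * P0 n" for n
    unfolding pn_def P0_def by (rule P.one_minus_void_le[OF fin_J])
  have pn_ge: "eventually (\<lambda>n. card (J n) * Q n \<le> pn n) sequentially"
    using S.eventually_t
  proof eventually_elim
    case (elim n)
    show ?case unfolding Q_def pn_def
    proof (rule P.one_minus_void_ge)
      show "linear_order R" using order by (simp add: translation_invariant_order_def)
      show "finite (J n)" "finite (A0 n)" by (simp_all add: fin_J A0_def finite_A_set)
      fix v w assume vw: "v \<in> J n" "w \<in> J n" "(v, w) \<in> R" "v \<noteq> w"
      have "\<bar>w $ l - v $ l\<bar> \<le> S.t n $ l" for l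
        using vw(1,2) S.s_le[of n l] unfolding J_def block_iff by (simp add: abs_le_iff) (smt (verit))
      then show "w - v \<in> A0 n"
        unfolding A0_def using elim by (intro A_set_diff[OF order vw(3,4)]) (simp_all add: S.t_def)
    qed
  qed
  have QP: "(\<lambda>n. Q n / P0 n) \<longlonglongrightarrow> 1"
    using cond_Dl unfolding cond_Dl_def cond_prob_def Q_def P0_def P.exc_def A0_def
    by (simp add: max_field_def SUP_le_iff)
  have Jvol: "(\<lambda>n. card (J n) / S.vol n) \<longlonglongrightarrow> 1" unfolding J_def by (rule S.shrink)
  have J_le: "card (J n) \<le> S.vol n" for n
    unfolding J_def card_block S.vol_def by (intro prod_mono) (simp add: nat_mono S.s_le)

  \<comment> \<open>A block has at most d n / (\<delta> k n) points, and the expected number of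
    exceedances in \<open>D n\<close> stays bounded.\<close>
  have pn_lim: "pn \<longlonglongrightarrow> 0"
  proof (rule Lim_null_comparison)
    show "eventually (\<lambda>n. norm (pn n) \<le> d n * P0 n / \<delta> / k n) sequentially"
      using \<delta>(2)
    proof eventually_elim
      case (elim n)
      have "real (S.vol n) * k n * \<delta> \<le> d n"
        using order_trans[OF mult_left_mono[OF S.vol_le[of n], of \<delta>] elim] \<delta>(1) by (simp add: mult_ac)
      then have "real (S.vol n) \<le> d n / \<delta> / k n"
        using \<delta>(1) k_pos[of n] by (simp add: pos_le_divide_eq mult_ac)
      then have "real (card (J n)) \<le> d n / \<delta> / k n" using J_le[of n] by linarith
      then have "card (J n) * P0 n \<le> d n / \<delta> / k n * P0 n"
        by (intro mult_right_mono) (auto simp: P0_def P.exc_def)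
      with pn_le[of n] pn_nonneg[of n] show ?case by (simp add: mult_ac)
    qed
    have "filterlim (\<lambda>n. real (k n)) at_top sequentially"
      by (rule filterlim_compose[OF filterlim_real_sequentially k_lim])
    then show "(\<lambda>n. d n * P0 n / \<delta> / k n) \<longlonglongrightarrow> 0"
      by (intro tendsto_divide_0[OF tendsto_divide[OF dP0 tendsto_const]] filterlim_at_top_imp_at_infinity)
        (use \<delta> in auto)
  qed
  \<comment> \<open>Sandwich: the union bound from above, the decomposition by the largest
    exceedance from below. Both bounds have the limit \<open>b g * \<tau>\<close>, as shrinking is
    negligible and \<open>Q n / P0 n\<close> tends to 1.\<close>
  have F_pn: "(\<lambda>n. card (F g n) * pn n) \<longlonglongrightarrow> b g * \<tau>" for g
  proof -
    let ?u = "\<lambda>n. card (F g n) * (card (J n) * P0 n)"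
    have "(\<lambda>n. card (F g n) * S.vol n / d n * (card (J n) / S.vol n) * (d n * P0 n)) \<longlonglongrightarrow> b g * 1 * \<tau>"
      by (intro tendsto_mult F_lim Jvol dP0)
    moreover have "eventually (\<lambda>n. card (F g n) * S.vol n / d n * (card (J n) / S.vol n) * (d n * P0 n) = ?u n) sequentially"
      using d_pos vol_pos by eventually_elim simp
    ultimately have "?u \<longlonglongrightarrow> b g * 1 * \<tau>" by (rule Lim_transform_eventually)
    then have u: "?u \<longlonglongrightarrow> b g * \<tau>" by simp
    have "(\<lambda>n. ?u n * (Q n / P0 n)) \<longlonglongrightarrow> b g * \<tau> * 1" by (intro tendsto_mult u QP)
    moreover have "eventually (\<lambda>n. ?u n * (Q n / P0 n) = card (F g n) * (card (J n) * Q n)) sequentially"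
      using P0_pos by eventually_elim simp
    ultimately have "(\<lambda>n. card (F g n) * (card (J n) * Q n)) \<longlonglongrightarrow> b g * \<tau> * 1"
      by (rule Lim_transform_eventually)
    then have low: "(\<lambda>n. card (F g n) * (card (J n) * Q n)) \<longlonglongrightarrow> b g * \<tau>" by simp
    have "eventually (\<lambda>n. card (F g n) * (card (J n) * Q n) \<le> card (F g n) * pn n) sequentially"
      using pn_ge by eventually_elim (intro mult_left_mono, auto)
    moreover have "eventually (\<lambda>n. card (F g n) * pn n \<le> ?u n) sequentially"
      by (intro always_eventually allI mult_left_mono pn_le) auto
    ultimately show ?thesis by (rule tendsto_sandwich[OF _ _ low u])
  qed
  have BP: "(\<lambda>n. card (B g n) * P0 n) \<longlonglongrightarrow> b g * \<tau>" for g
  proof -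
    have "(\<lambda>n. card (B g n) / d n * (d n * P0 n)) \<longlonglongrightarrow> b g * \<tau>"
      using b_lim by (intro tendsto_mult dP0) (simp add: d_def)
    moreover have "eventually (\<lambda>n. card (B g n) / d n * (d n * P0 n) = card (B g n) * P0 n) sequentially"
      using d_pos by eventually_elim simp
    ultimately show ?thesis by (rule Lim_transform_eventually)
  qed

  have mix: "P.mixing (x n) (K_set \<kappa> (c n)) (\<gamma> n) (\<alpha> n)" for n
    using cond_D unfolding cond_D_def P.mixing_def P.max_field_le by blast
  have F_alpha: "(\<lambda>n. (\<Sum>g\<in>UNIV. card (F g n)) * \<alpha> n) \<longlonglongrightarrow> 0"
  proof (rule Lim_null_comparison)
    show "eventually (\<lambda>n. norm ((\<Sum>g\<in>UNIV. card (F g n)) * \<alpha> n)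
        \<le> CARD('g) * (8 * \<kappa> + 9) ^ CARD('d) * \<bar>k n * \<alpha> n\<bar>) sequentially"
      using F_le_all
    proof eventually_elim
      case (elim n)
      have "real (\<Sum>g\<in>UNIV. card (F g n)) \<le> (\<Sum>g\<in>(UNIV :: 'g set). (8 * \<kappa> + 9) ^ CARD('d) * k n)"
        unfolding of_nat_sum using elim by (intro sum_mono) auto
      then have "real (\<Sum>g\<in>UNIV. card (F g n)) * \<bar>\<alpha> n\<bar> \<le> CARD('g) * ((8 * \<kappa> + 9) ^ CARD('d) * k n) * \<bar>\<alpha> n\<bar>"
        by (intro mult_right_mono) auto
      then show ?case by (simp add: abs_mult mult_ac sum_nonneg)
    qed
    have "(\<lambda>n. CARD('g) * (8 * \<kappa> + 9) ^ CARD('d) * \<bar>k n * \<alpha> n\<bar>) \<longlonglongrightarrow> CARD('g) * (8 * \<kappa> + 9) ^ CARD('d) * \<bar>0\<bar>"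
      by (intro tendsto_mult_left tendsto_rabs k_alpha)
    then show "(\<lambda>n. CARD('g) * (8 * \<kappa> + 9) ^ CARD('d) * \<bar>k n * \<alpha> n\<bar>) \<longlonglongrightarrow> 0" by simp
  qed

  have laplace: "(\<lambda>n. P.expectation (\<lambda>\<omega>. exp (- (\<Sum>g\<in>UNIV. j g * P.count (x n) (B g n) \<omega>))))
      \<longlonglongrightarrow> (\<Prod>g\<in>UNIV. exp (- ((1 - exp (- real (j g))) * (b g * \<tau>))))" (is "?E \<longlonglongrightarrow> ?l") for j :: "'g \<Rightarrow> nat"
  proof -
    let ?G = "\<lambda>n. \<Prod>g\<in>UNIV. (1 - (1 - exp (- real (j g))) * pn n) ^ card (F g n)"
    have G: "?G \<longlonglongrightarrow> ?l"
    proof (intro tendsto_prod power_tendsto_exp)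
      fix g
      show "0 \<le> (1 - exp (- real (j g))) * pn n" for n using pn_nonneg by simp
      show "(\<lambda>n. (1 - exp (- real (j g))) * pn n) \<longlonglongrightarrow> 0"
        using tendsto_mult_left[OF pn_lim, of "1 - exp (- real (j g))"] by simp
      show "(\<lambda>n. card (F g n) * ((1 - exp (- real (j g))) * pn n)) \<longlonglongrightarrow> (1 - exp (- real (j g))) * (b g * \<tau>)"
        using tendsto_mult_left[OF F_pn, of "1 - exp (- real (j g))" g] by (simp add: mult_ac)
    qed
    \<comment> \<open>In the second sum both means tend to \<open>b g * \<tau>\<close>, so their
      difference vanishes for each \<open>g\<close>.\<close>
    let ?err = "\<lambda>n. (\<Sum>g\<in>UNIV. card (F g n)) * \<alpha> n + (\<Sum>g\<in>UNIV. j g * (card (B g n) * P0 n - card (F g n) * pn n))"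
    have "?err \<longlonglongrightarrow> 0 + (\<Sum>g\<in>UNIV. j g * (b g * \<tau> - b g * \<tau>))"
      by (intro tendsto_add tendsto_sum tendsto_mult tendsto_const tendsto_diff F_alpha BP F_pn)
    then have err: "?err \<longlonglongrightarrow> 0" by simp
    have "eventually (\<lambda>n. norm (?E n - ?G n) \<le> ?err n) sequentially"
      using DK S.eventually_t F_le_all
    proof eventually_elim
      case (elim n)
      have t: "0 < S.t n $ l" for l using elim by blast
      have "\<bar>?E n - ?G n\<bar> \<le> ?err n"
        unfolding pn_def J_def P0_def
      proof (rule P.laplace_counts[OF mix t S.s_le S.gamma_le])
        \<comment> \<open>A tile is nonempty, since it contains its base point, and so cannot lie in
          two disjoint sets.\<close>
        show "F g n \<inter> F g' n = {}" if "g \<noteq> g'" for g g'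
        proof -
          have "B g n \<inter> B g' n = {}" using B_disj[of n] that by (simp add: disjoint_family_on_def)
          then show ?thesis using base_in_block[OF t] unfolding F_def full_blocks_def by blast
        qed
        show "block (S.t n) (S.s n) z \<subseteq> B g n" if "z \<in> F g n" for g z
        proof -
          have "block (S.t n) (S.s n) z \<subseteq> block (S.t n) (S.t n) z"
            by (rule block_mono[OF S.s_le])
          with that show ?thesis by (auto simp: F_def full_blocks_def)
        qed
      qed (use elim fin_B B_sub in blast)+
      then show ?case by simp
    qed
    from Lim_null_comparison[OF this err] have "(\<lambda>n. ?E n - ?G n) \<longlonglongrightarrow> 0" .
    from tendsto_add[OF this G] show ?thesis by simp
  qed

  have L_meas: "L g \<in> N \<rightarrow>\<^sub>M count_space UNIV" for g using L_indep by (simp add: N.indep_vars_def)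
  have eq: "exceedances \<xi> (D n) (x n) (B g n) = P.count (x n) (B g n)" for g n
    using exceedances_eq_count[OF field fin_B B_sub] by auto
  show ?thesis
  proof (rule converges_in_distribution_laplace[OF prob prob_N])
    show "(\<lambda>\<omega>. \<chi> g. exceedances \<xi> (D n) (x n) (B g n) \<omega>) \<in> borel_measurable M" for n
      by (intro borel_measurable_vec) (simp add: eq)
    show "(\<lambda>\<omega>. \<chi> g. real (L g \<omega>)) \<in> borel_measurable N"
      by (intro borel_measurable_vec) (simp add: measurable_compose[OF L_meas])
    show "0 \<le> (\<chi> g. exceedances \<xi> (D n) (x n) (B g n) \<omega>) $ g" for n \<omega> g
      by (simp add: eq P.count_def sum_nonneg)
    show "(\<lambda>n. \<integral>\<omega>. exp (- (\<Sum>g\<in>UNIV. real (j g) * (\<chi> g. exceedances \<xi> (D n) (x n) (B g n) \<omega>) $ g)) \<partial>M)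
        \<longlonglongrightarrow> (\<integral>\<omega>. exp (- (\<Sum>g\<in>UNIV. real (j g) * (\<chi> g. real (L g \<omega>)) $ g)) \<partial>N)" for j
      using laplace[of j] laplace_indep_poisson[OF prob_N L_indep L_poisson, of j] b_nonneg tau_pos
      by (simp add: eq)
  qed simp
qed

end
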